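(* Suppose $\Lambda$ is a row-finite $k$-graph with no sources, that $K$ is a field, and $\eta:\Lambda\to G$ is a functor with values in a group $G$. Then there is a $G$-grading of the Kumjian--Pask algebra $\operatorname{KP}_K(\Lambda)$ with \[ \operatorname{KP}_K(\Lambda)_g:=\operatorname{span}\{s_\lambda s_{\mu^*}:\lambda,\mu\in\Lambda,\ \eta(\lambda)\eta(\mu)^{-1}=g\}\qquad(g\in G). \]
   Context: A $k$-graph is a countable small category $\Lambda$ with a functor $d:\Lambda\to\mathbb{N}^k$ satisfying the factorisation property: if $d(\lambda)=m+n$, there are unique $\mu,\nu$ with $\lambda=\mu\nu$, $d(\mu)=m$, $d(\nu)=n$. Range and source (codomain and domain) are written $r,s$, so $\lambda\mu$ is defined exactly when $s(\lambda)=r(\mu)$. $\Lambda^n:=d^{-1}(n)$, $\Lambda^0$ is identified with the set of objects, $v\Lambda^n:=\{\lambda\in\Lambda^n:r(\lambda)=v\}$. Row-finite with no sources means every $v\Lambda^n$ is finite and nonempty. A functor $\eta:\Lambda\to G$ is a map with $\eta(\lambda\mu)=\eta(\lambda)\eta(\mu)$ for composable $\lambda,\mu$ and $\eta(v)=e$ for $v\in\Lambda^0$. The Kumjian--Pask algebra $\operatorname{KP}_K(\Lambda)$ is the universal $K$-algebra generated by elements $p_v$ ($v\in\Lambda^0$) and $s_\lambda$, $s_{\lambda^*}$ ($\lambda\in\Lambda$, $d(\lambda)\ne0$), with the convention $s_v=s_{v^*}=p_v$ for $v\in\Lambda^0$, subject to: (KP1) the $p_v$ are mutually orthogonal idempotents;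 (KP2) for $\lambda,\mu$ of nonzero degree with $s(\lambda)=r(\mu)$, $s_\lambda s_\mu=s_{\lambda\mu}$ and $s_{\mu^*}s_{\lambda^*}=s_{(\lambda\mu)^*}$, and for all $\lambda$ of nonzero degree $p_{r(\lambda)}s_\lambda=s_\lambda=s_\lambda p_{s(\lambda)}$ and $p_{s(\lambda)}s_{\lambda^*}=s_{\lambda^*}=s_{\lambda^*}p_{r(\lambda)}$; (KP3) $s_{\lambda^*}s_\mu=\delta_{\lambda,\mu}p_{s(\lambda)}$ whenever $d(\lambda)=d(\mu)\ne0$; (KP4) $p_v=\sum_{\lambda\in v\Lambda^n}s_\lambda s_{\lambda^*}$ for all $v\in\Lambda^0$ and $n\in\mathbb{N}^k\setminus\{0\}$. A $G$-grading of a ring $R$ is a family of additive subgroups $R_g$ ($g\in G$) with $R_gR_h\subset R_{gh}$ such that $R$ is the direct sum of the $R_g$, that is, each $r\in R$ has a unique expansion as a finite sum $r=\sum_gr_g$ with $r_g\in R_g$. Span means $K$-linear span. *)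

theory Defs
  imports
    "HOL-Library.Poly_Mapping"
    "HOL-Library.Function_Algebras"
    "HOL-Library.Countable_Set"
    "HOL-Algebra.Module"
    "HOL-Algebra.QuotRing"
begin

section \<open>Higher-rank graphs\<close>

text \<open>
  Small categories are given by their morphisms, with every object identified with its identity
  morphism; thus \<open>rng\<close> (codomain) and \<open>src\<close> (domain) return identity morphisms, and
  \<open>comp \<Lambda> \<alpha> \<beta>\<close> is the composite \<open>\<alpha>\<beta>\<close>, meaningful when \<open>src \<Lambda> \<alpha> = rng \<Lambda> \<beta>\<close>.
\<close>

record 'm kgraph =
  mor :: "'m set"
  rng :: "'m \<Rightarrow> 'm"
  src :: "'m \<Rightarrow> 'm"
  comp :: "'m \<Rightarrow> 'm \<Rightarrow> 'm"
  deg :: "'m \<Rightarrow> nat \<Rightarrow> nat"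

text \<open>The monoid \<open>\<nat>\<^sup>k\<close> is the set of functions on \<open>\<nat>\<close> vanishing from \<open>k\<close> on, with pointwise addition.\<close>

definition nat_tuples :: "nat \<Rightarrow> (nat \<Rightarrow> nat) set" where
  "nat_tuples k = {n. \<forall>i\<ge>k. n i = 0}"

locale small_category =
  fixes \<Lambda> :: "'m kgraph"
  assumes rng_closed: "\<alpha> \<in> mor \<Lambda> \<Longrightarrow> rng \<Lambda> \<alpha> \<in> mor \<Lambda>"
    and src_closed: "\<alpha> \<in> mor \<Lambda> \<Longrightarrow> src \<Lambda> \<alpha> \<in> mor \<Lambda>"
    and rng_rng: "\<alpha> \<in> mor \<Lambda> \<Longrightarrow> rng \<Lambda> (rng \<Lambda> \<alpha>) = rng \<Lambda> \<alpha>"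
    and src_rng: "\<alpha> \<in> mor \<Lambda> \<Longrightarrow> src \<Lambda> (rng \<Lambda> \<alpha>) = rng \<Lambda> \<alpha>"
    and rng_src: "\<alpha> \<in> mor \<Lambda> \<Longrightarrow> rng \<Lambda> (src \<Lambda> \<alpha>) = src \<Lambda> \<alpha>"
    and src_src: "\<alpha> \<in> mor \<Lambda> \<Longrightarrow> src \<Lambda> (src \<Lambda> \<alpha>) = src \<Lambda> \<alpha>"
    and comp_closed: "\<lbrakk>\<alpha> \<in> mor \<Lambda>; \<beta> \<in> mor \<Lambda>; src \<Lambda> \<alpha> = rng \<Lambda> \<beta>\<rbrakk> \<Longrightarrow> comp \<Lambda> \<alpha> \<beta> \<in> mor \<Lambda>"
    and rng_comp: "\<lbrakk>\<alpha> \<in> mor \<Lambda>; \<beta> \<in> mor \<Lambda>; src \<Lambda> \<alpha> = rng \<Lambda> \<beta>\<rbrakk> \<Longrightarrow> rng \<Lambda> (comp \<Lambda> \<alpha> \<beta>) = rng \<Lambda> \<alpha>"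
    and src_comp: "\<lbrakk>\<alpha> \<in> mor \<Lambda>; \<beta> \<in> mor \<Lambda>; src \<Lambda> \<alpha> = rng \<Lambda> \<beta>\<rbrakk> \<Longrightarrow> src \<Lambda> (comp \<Lambda> \<alpha> \<beta>) = src \<Lambda> \<beta>"
    and comp_rng: "\<alpha> \<in> mor \<Lambda> \<Longrightarrow> comp \<Lambda> (rng \<Lambda> \<alpha>) \<alpha> = \<alpha>"
    and comp_src: "\<alpha> \<in> mor \<Lambda> \<Longrightarrow> comp \<Lambda> \<alpha> (src \<Lambda> \<alpha>) = \<alpha>"
    and comp_assoc: "\<lbrakk>\<alpha> \<in> mor \<Lambda>; \<beta> \<in> mor \<Lambda>; \<gamma> \<in> mor \<Lambda>; src \<Lambda> \<alpha> = rng \<Lambda> \<beta>; src \<Lambda> \<beta> = rng \<Lambda> \<gamma>\<rbrakk>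
      \<Longrightarrow> comp \<Lambda> (comp \<Lambda> \<alpha> \<beta>) \<gamma> = comp \<Lambda> \<alpha> (comp \<Lambda> \<beta> \<gamma>)"

locale k_graph = small_category \<Lambda> for k :: nat and \<Lambda> :: "'m kgraph" +
  assumes countable_mor: "countable (mor \<Lambda>)"
    and deg_closed: "\<alpha> \<in> mor \<Lambda> \<Longrightarrow> deg \<Lambda> \<alpha> \<in> nat_tuples k"
    and deg_rng: "\<alpha> \<in> mor \<Lambda> \<Longrightarrow> deg \<Lambda> (rng \<Lambda> \<alpha>) = 0"
    and deg_src: "\<alpha> \<in> mor \<Lambda> \<Longrightarrow> deg \<Lambda> (src \<Lambda> \<alpha>) = 0"
    and deg_comp: "\<lbrakk>\<alpha> \<in> mor \<Lambda>; \<beta> \<in> mor \<Lambda>; src \<Lambda> \<alpha> = rng \<Lambda> \<beta>\<rbrakk>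
      \<Longrightarrow> deg \<Lambda> (comp \<Lambda> \<alpha> \<beta>) = deg \<Lambda> \<alpha> + deg \<Lambda> \<beta>"
    and factorisation: "\<lbrakk>\<alpha> \<in> mor \<Lambda>; m \<in> nat_tuples k; n \<in> nat_tuples k; deg \<Lambda> \<alpha> = m + n\<rbrakk>
      \<Longrightarrow> \<exists>!(\<beta>, \<gamma>). \<beta> \<in> mor \<Lambda> \<and> \<gamma> \<in> mor \<Lambda> \<and> src \<Lambda> \<beta> = rng \<Lambda> \<gamma>
            \<and> \<alpha> = comp \<Lambda> \<beta> \<gamma> \<and> deg \<Lambda> \<beta> = m \<and> deg \<Lambda> \<gamma> = n"

definition paths :: "'m kgraph \<Rightarrow> (nat \<Rightarrow> nat) \<Rightarrow> 'm set" where
  "paths \<Lambda> n = {\<alpha> \<in> mor \<Lambda>. deg \<Lambda> \<alpha> = n}"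

abbreviation vertices :: "'m kgraph \<Rightarrow> 'm set" where
  "vertices \<Lambda> \<equiv> paths \<Lambda> 0"

definition paths_at :: "'m kgraph \<Rightarrow> 'm \<Rightarrow> (nat \<Rightarrow> nat) \<Rightarrow> 'm set" where
  "paths_at \<Lambda> v n = {\<alpha> \<in> paths \<Lambda> n. rng \<Lambda> \<alpha> = v}"

text \<open>The factorisation property makes the morphisms of degree \<open>0\<close> exactly the identity morphisms.\<close>

lemma (in k_graph) vertices_eq_identities: "vertices \<Lambda> = rng \<Lambda> ` mor \<Lambda>"
proof
  show "rng \<Lambda> ` mor \<Lambda> \<subseteq> vertices \<Lambda>"
    by (auto simp: paths_def rng_closed deg_rng)
  show "vertices \<Lambda> \<subseteq> rng \<Lambda> ` mor \<Lambda>"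
  proof
    fix v assume "v \<in> vertices \<Lambda>"
    then have v: "v \<in> mor \<Lambda>" "deg \<Lambda> v = 0" by (auto simp: paths_def)
    have z: "0 \<in> nat_tuples k" by (simp add: nat_tuples_def)
    let ?P = "\<lambda>(\<beta>, \<gamma>). \<beta> \<in> mor \<Lambda> \<and> \<gamma> \<in> mor \<Lambda> \<and> src \<Lambda> \<beta> = rng \<Lambda> \<gamma>
            \<and> v = comp \<Lambda> \<beta> \<gamma> \<and> deg \<Lambda> \<beta> = 0 \<and> deg \<Lambda> \<gamma> = 0"
    have ex: "\<exists>!x. ?P x"
      using factorisation[OF v(1) z z] v(2) by simp
    have "?P (rng \<Lambda> v, v)" "?P (v, src \<Lambda> v)"
      using v by (simp_all add: rng_closed src_closed src_rng rng_src comp_rng comp_src deg_rng deg_src)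
    with ex have "(rng \<Lambda> v, v) = (v, src \<Lambda> v)" by blast
    then show "v \<in> rng \<Lambda> ` mor \<Lambda>" using v(1) by (metis imageI prod.inject)
  qed
qed

definition row_finite_no_sources :: "nat \<Rightarrow> 'm kgraph \<Rightarrow> bool" where
  "row_finite_no_sources k \<Lambda> \<longleftrightarrow>
    (\<forall>v\<in>vertices \<Lambda>. \<forall>n\<in>nat_tuples k. finite (paths_at \<Lambda> v n) \<and> paths_at \<Lambda> v n \<noteq> {})"

definition functor_to_group :: "'m kgraph \<Rightarrow> ('g, 'x) monoid_scheme \<Rightarrow> ('m \<Rightarrow> 'g) \<Rightarrow> bool" where
  "functor_to_group \<Lambda> G \<eta> \<longleftrightarrow>
    (\<forall>\<alpha>\<in>mor \<Lambda>. \<eta> \<alpha> \<in> carrier G) \<and>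
    (\<forall>\<alpha>\<in>mor \<Lambda>. \<forall>\<beta>\<in>mor \<Lambda>. src \<Lambda> \<alpha> = rng \<Lambda> \<beta> \<longrightarrow> \<eta> (comp \<Lambda> \<alpha> \<beta>) = \<eta> \<alpha> \<otimes>\<^bsub>G\<^esub> \<eta> \<beta>) \<and>
    (\<forall>v\<in>vertices \<Lambda>. \<eta> v = \<one>\<^bsub>G\<^esub>)"


section \<open>Algebras given by generators and relations\<close>

text \<open>
  Algebras need not have a unit. They are represented by the record \<open>module\<close>,
  whose component \<open>one\<close> is left undefined and never used; the field of scalars is a type of
  class \<open>field\<close>.

  The free monoid is written additively because the convolution product of finitely supported
  functions requires an additive monoid of exponents.
\<close>

datatype 'x free_monoid = Word (letters: "'x list")

instantiation free_monoid :: (type) monoid_add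
begin

definition "0 = Word []"

definition "u + w = Word (letters u @ letters w)"

instance
  by standard (simp_all add: zero_free_monoid_def plus_free_monoid_def)

end

text \<open>The free non-unital algebra on \<open>X\<close>: linear combinations of nonempty words in \<open>X\<close>.\<close>

definition free_algebra :: "'x set \<Rightarrow> ('k::field, 'x free_monoid \<Rightarrow>\<^sub>0 'k) module" where
  "free_algebra X =
    \<lparr>carrier = {f. \<forall>w\<in>Poly_Mapping.keys f. w \<noteq> 0 \<and> set (letters w) \<subseteq> X},
     mult = (*), one = undefined, zero = 0, add = (+),
     smult = (\<lambda>c. Poly_Mapping.map ((*) c))\<rparr>"

definition letter :: "'x \<Rightarrow> 'x free_monoid \<Rightarrow>\<^sub>0 'k::field" where
  "letter x = Poly_Mapping.single (Word [x]) 1"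

inductive_set algebra_ideal :: "('k, 'a, 'b) module_scheme \<Rightarrow> 'a set \<Rightarrow> 'a set"
  for A :: "('k, 'a, 'b) module_scheme" and S :: "'a set" where
  ideal_zero: "\<zero>\<^bsub>A\<^esub> \<in> algebra_ideal A S"
| ideal_base: "x \<in> S \<Longrightarrow> x \<in> algebra_ideal A S"
| ideal_add: "\<lbrakk>x \<in> algebra_ideal A S; y \<in> algebra_ideal A S\<rbrakk> \<Longrightarrow> x \<oplus>\<^bsub>A\<^esub> y \<in> algebra_ideal A S"
| ideal_smult: "x \<in> algebra_ideal A S \<Longrightarrow> c \<odot>\<^bsub>A\<^esub> x \<in> algebra_ideal A S"
| ideal_lmult: "\<lbrakk>a \<in> carrier A; x \<in> algebra_ideal A S\<rbrakk> \<Longrightarrow> a \<otimes>\<^bsub>A\<^esub> x \<in> algebra_ideal A S"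
| ideal_rmult: "\<lbrakk>x \<in> algebra_ideal A S; a \<in> carrier A\<rbrakk> \<Longrightarrow> x \<otimes>\<^bsub>A\<^esub> a \<in> algebra_ideal A S"

inductive_set linear_span :: "('k, 'a, 'b) module_scheme \<Rightarrow> 'a set \<Rightarrow> 'a set"
  for A :: "('k, 'a, 'b) module_scheme" and S :: "'a set" where
  span_zero: "\<zero>\<^bsub>A\<^esub> \<in> linear_span A S"
| span_base: "x \<in> S \<Longrightarrow> x \<in> linear_span A S"
| span_add: "\<lbrakk>x \<in> linear_span A S; y \<in> linear_span A S\<rbrakk> \<Longrightarrow> x \<oplus>\<^bsub>A\<^esub> y \<in> linear_span A S"
| span_smult: "x \<in> linear_span A S \<Longrightarrow> c \<odot>\<^bsub>A\<^esub> x \<in> linear_span A S"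

definition quotient_algebra ::
    "('k, 'a, 'b) module_scheme \<Rightarrow> 'a set \<Rightarrow> ('k, 'a set) module" where
  "quotient_algebra A I =
    \<lparr>carrier = a_rcosets\<^bsub>A\<^esub> I, mult = rcoset_mult A I, one = undefined, zero = I, add = set_add A,
     smult = (\<lambda>c U. \<Union>a\<in>U. I +>\<^bsub>A\<^esub> (c \<odot>\<^bsub>A\<^esub> a))\<rparr>"


section \<open>The Kumjian--Pask algebra\<close>

datatype 'm kp_gen = Vertex 'm | Path 'm | Ghost 'm

definition kp_gens :: "'m kgraph \<Rightarrow> 'm kp_gen set" where
  "kp_gens \<Lambda> = Vertex ` vertices \<Lambda> \<union> Path ` {\<alpha> \<in> mor \<Lambda>. deg \<Lambda> \<alpha> \<noteq> 0}
     \<union> Ghost ` {\<alpha> \<in> mor \<Lambda>. deg \<Lambda> \<alpha> \<noteq> 0}"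

text \<open>The elements \<open>p\<^sub>v\<close>, \<open>s\<^sub>\<alpha>\<close> and \<open>s\<^sub>\<alpha>\<^sub>*\<close> of the free algebra, with the convention \<open>s\<^sub>v = s\<^sub>v\<^sub>* = p\<^sub>v\<close>.\<close>

definition fp :: "'m \<Rightarrow> 'm kp_gen free_monoid \<Rightarrow>\<^sub>0 'k::field" where
  "fp v = letter (Vertex v)"

definition fs :: "'m kgraph \<Rightarrow> 'm \<Rightarrow> 'm kp_gen free_monoid \<Rightarrow>\<^sub>0 'k::field" where
  "fs \<Lambda> \<alpha> = (if deg \<Lambda> \<alpha> = 0 then fp \<alpha> else letter (Path \<alpha>))"

definition fs_star :: "'m kgraph \<Rightarrow> 'm \<Rightarrow> 'm kp_gen free_monoid \<Rightarrow>\<^sub>0 'k::field" where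
  "fs_star \<Lambda> \<alpha> = (if deg \<Lambda> \<alpha> = 0 then fp \<alpha> else letter (Ghost \<alpha>))"

text \<open>A relation \<open>a = b\<close> is represented by \<open>a - b\<close>.\<close>

inductive_set kp_relations :: "nat \<Rightarrow> 'm kgraph \<Rightarrow> ('m kp_gen free_monoid \<Rightarrow>\<^sub>0 'k::field) set"
  for k :: nat and \<Lambda> :: "'m kgraph" where
  KP1_idem: "v \<in> vertices \<Lambda> \<Longrightarrow> fp v * fp v - fp v \<in> kp_relations k \<Lambda>"
| KP1_orth: "\<lbrakk>v \<in> vertices \<Lambda>; w \<in> vertices \<Lambda>; v \<noteq> w\<rbrakk> \<Longrightarrow> fp v * fp w \<in> kp_relations k \<Lambda>"
| KP2_comp: "\<lbrakk>\<alpha> \<in> mor \<Lambda>; \<beta> \<in> mor \<Lambda>; deg \<Lambda> \<alpha> \<noteq> 0; deg \<Lambda> \<beta> \<noteq> 0; src \<Lambda> \<alpha> = rng \<Lambda> \<beta>\<rbrakk>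
    \<Longrightarrow> fs \<Lambda> \<alpha> * fs \<Lambda> \<beta> - fs \<Lambda> (comp \<Lambda> \<alpha> \<beta>) \<in> kp_relations k \<Lambda>"
| KP2_comp_star: "\<lbrakk>\<alpha> \<in> mor \<Lambda>; \<beta> \<in> mor \<Lambda>; deg \<Lambda> \<alpha> \<noteq> 0; deg \<Lambda> \<beta> \<noteq> 0; src \<Lambda> \<alpha> = rng \<Lambda> \<beta>\<rbrakk>
    \<Longrightarrow> fs_star \<Lambda> \<beta> * fs_star \<Lambda> \<alpha> - fs_star \<Lambda> (comp \<Lambda> \<alpha> \<beta>) \<in> kp_relations k \<Lambda>"
| KP2_rng: "\<lbrakk>\<alpha> \<in> mor \<Lambda>; deg \<Lambda> \<alpha> \<noteq> 0\<rbrakk> \<Longrightarrow> fp (rng \<Lambda> \<alpha>) * fs \<Lambda> \<alpha> - fs \<Lambda> \<alpha> \<in> kp_relations k \<Lambda>"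
| KP2_src: "\<lbrakk>\<alpha> \<in> mor \<Lambda>; deg \<Lambda> \<alpha> \<noteq> 0\<rbrakk> \<Longrightarrow> fs \<Lambda> \<alpha> * fp (src \<Lambda> \<alpha>) - fs \<Lambda> \<alpha> \<in> kp_relations k \<Lambda>"
| KP2_src_star: "\<lbrakk>\<alpha> \<in> mor \<Lambda>; deg \<Lambda> \<alpha> \<noteq> 0\<rbrakk>
    \<Longrightarrow> fp (src \<Lambda> \<alpha>) * fs_star \<Lambda> \<alpha> - fs_star \<Lambda> \<alpha> \<in> kp_relations k \<Lambda>"
| KP2_rng_star: "\<lbrakk>\<alpha> \<in> mor \<Lambda>; deg \<Lambda> \<alpha> \<noteq> 0\<rbrakk>
    \<Longrightarrow> fs_star \<Lambda> \<alpha> * fp (rng \<Lambda> \<alpha>) - fs_star \<Lambda> \<alpha> \<in> kp_relations k \<Lambda>"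
| KP3: "\<lbrakk>\<alpha> \<in> mor \<Lambda>; \<beta> \<in> mor \<Lambda>; deg \<Lambda> \<alpha> = deg \<Lambda> \<beta>; deg \<Lambda> \<alpha> \<noteq> 0\<rbrakk>
    \<Longrightarrow> fs_star \<Lambda> \<alpha> * fs \<Lambda> \<beta> - (if \<alpha> = \<beta> then fp (src \<Lambda> \<alpha>) else 0) \<in> kp_relations k \<Lambda>"
| KP4: "\<lbrakk>v \<in> vertices \<Lambda>; n \<in> nat_tuples k; n \<noteq> 0\<rbrakk>
    \<Longrightarrow> fp v - (\<Sum>\<alpha>\<in>paths_at \<Lambda> v n. fs \<Lambda> \<alpha> * fs_star \<Lambda> \<alpha>) \<in> kp_relations k \<Lambda>"

definition kp_ideal :: "nat \<Rightarrow> 'm kgraph \<Rightarrow> ('m kp_gen free_monoid \<Rightarrow>\<^sub>0 'k::field) set" where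
  "kp_ideal k \<Lambda> = algebra_ideal (free_algebra (kp_gens \<Lambda>)) (kp_relations k \<Lambda>)"

definition kp_algebra ::
    "nat \<Rightarrow> 'm kgraph \<Rightarrow> ('k::field, ('m kp_gen free_monoid \<Rightarrow>\<^sub>0 'k) set) module" where
  "kp_algebra k \<Lambda> = quotient_algebra (free_algebra (kp_gens \<Lambda>)) (kp_ideal k \<Lambda>)"

definition kp_s :: "nat \<Rightarrow> 'm kgraph \<Rightarrow> 'm \<Rightarrow> ('m kp_gen free_monoid \<Rightarrow>\<^sub>0 'k::field) set" where
  "kp_s k \<Lambda> \<alpha> = kp_ideal k \<Lambda> +>\<^bsub>free_algebra (kp_gens \<Lambda>) :: ('k, _) module\<^esub> fs \<Lambda> \<alpha>"

definition kp_s_star :: "nat \<Rightarrow> 'm kgraph \<Rightarrow> 'm \<Rightarrow> ('m kp_gen free_monoid \<Rightarrow>\<^sub>0 'k::field) set" where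
  "kp_s_star k \<Lambda> \<alpha> = kp_ideal k \<Lambda> +>\<^bsub>free_algebra (kp_gens \<Lambda>) :: ('k, _) module\<^esub> fs_star \<Lambda> \<alpha>"


section \<open>Gradings\<close>

definition is_grading ::
    "('g, 'x) monoid_scheme \<Rightarrow> ('a, 'b) ring_scheme \<Rightarrow> ('g \<Rightarrow> 'a set) \<Rightarrow> bool" where
  "is_grading G R D \<longleftrightarrow>
    (\<forall>g\<in>carrier G. additive_subgroup (D g) R) \<and>
    (\<forall>g\<in>carrier G. \<forall>h\<in>carrier G. \<forall>x\<in>D g. \<forall>y\<in>D h. x \<otimes>\<^bsub>R\<^esub> y \<in> D (g \<otimes>\<^bsub>G\<^esub> h)) \<and>
    (\<forall>r\<in>carrier R. \<exists>!f. f \<in> (\<Pi>\<^sub>E g\<in>carrier G. D g) \<and>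
        finite {g \<in> carrier G. f g \<noteq> \<zero>\<^bsub>R\<^esub>} \<and>
        r = (\<Oplus>\<^bsub>R\<^esub>g\<in>{g \<in> carrier G. f g \<noteq> \<zero>\<^bsub>R\<^esub>}. f g))"

end

theory Submission
  imports Defs
begin

text \<open>
  The free algebra on the generators is graded by \<open>G\<close>, with \<open>p\<^sub>v\<close> in degree \<open>e\<close>, \<open>s\<^sub>\<alpha>\<close> in degree
  \<open>\<eta>(\<alpha>)\<close> and \<open>s\<^sub>\<alpha>\<^sub>*\<close> in degree \<open>\<eta>(\<alpha>)\<^sup>-\<^sup>1\<close>. Every Kumjian--Pask relation is homogeneous, so the
  ideal of relations contains the homogeneous components of its elements, and the quotient is graded
  by the images of the homogeneous parts. Such an image is spanned by the classes of words of the given degree,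
  and each word reduces to a combination of elements \<open>s\<^sub>\<alpha> s\<^sub>\<beta>\<^sub>*\<close> of the same degree: when these are
  multiplied on the right by a generator, the only serious case is
  \<open>s\<^sub>\<beta>\<^sub>* s\<^sub>\<gamma> = \<Sum> s\<^sub>\<nu> s\<^sub>\<epsilon>\<^sub>*\<close>, the sum running over the \<open>\<epsilon>\<close> of degree \<open>d(\<beta>)\<close> with \<open>\<gamma>\<epsilon> = \<beta>\<nu>\<close> for
  some (unique) \<open>\<nu>\<close>.
\<close>

section \<open>Algebras presented by generators and relations\<close>

text \<open>Reduces identities that are linear in \<open>x\<close> to monomials; both the component
  formulas for products and the reduction of arbitrary elements to words rest on it.\<close>

lemma poly_mapping_expansion:
  fixes x :: "'a \<Rightarrow>\<^sub>0 'b::comm_monoid_add"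
  shows "x = (\<Sum>w\<in>Poly_Mapping.keys x. Poly_Mapping.single w (Poly_Mapping.lookup x w))"
proof (rule poly_mapping_eqI)
  fix u
  have "(\<Sum>w\<in>Poly_Mapping.keys x. Poly_Mapping.lookup (Poly_Mapping.single w (Poly_Mapping.lookup x w)) u)
      = (\<Sum>w\<in>Poly_Mapping.keys x. if w = u then Poly_Mapping.lookup x u else 0)"
    by (rule sum.cong) (auto simp: lookup_single)
  then show "Poly_Mapping.lookup x u = Poly_Mapping.lookup (\<Sum>w\<in>Poly_Mapping.keys x. Poly_Mapping.single w (Poly_Mapping.lookup x w)) u"
    by (simp add: lookup_sum in_keys_iff)
qed

section \<open>Words and the carrier of the free non-unital algebra\<close>

lemma letters_plus [simp]: "letters (u + w) = letters u @ letters w"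
  by (simp add: plus_free_monoid_def)

lemma letters_eq_Nil_iff: "letters w = [] \<longleftrightarrow> w = 0"
  by (cases w) (simp add: zero_free_monoid_def)

lemma plus_free_monoid_eq_0_iff: "u + w = (0 :: 'x free_monoid) \<longleftrightarrow> u = 0 \<and> w = 0"
  by (simp flip: letters_eq_Nil_iff)

text \<open>Scalar multiplication becomes left multiplication by \<open>c\<close> times the empty
  word. The unit of the ambient ring of all finitely supported functions lies outside the non-unital
  carrier, but using it lets the ring laws of that type handle scalars.\<close>

lemma free_algebra_simps [simp]:
  "x \<otimes>\<^bsub>free_algebra X\<^esub> y = x * y"
  "x \<oplus>\<^bsub>free_algebra X\<^esub> y = x + y"
  "\<zero>\<^bsub>free_algebra X\<^esub> = 0"
  "c \<odot>\<^bsub>free_algebra X\<^esub> x = Poly_Mapping.single 0 c * x"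
  by (simp_all add: free_algebra_def mult_map_scale_conv_mult)

lemma free_algebra_carrier_iff:
  "x \<in> carrier (free_algebra X) \<longleftrightarrow> (\<forall>w\<in>Poly_Mapping.keys x. w \<noteq> 0 \<and> set (letters w) \<subseteq> X)"
  by (simp add: free_algebra_def)

lemma free_algebra_zero_closed [simp]: "0 \<in> carrier (free_algebra X)"
  by (simp add: free_algebra_carrier_iff)

lemma free_algebra_add_closed [simp]:
  "\<lbrakk>x \<in> carrier (free_algebra X); y \<in> carrier (free_algebra X)\<rbrakk> \<Longrightarrow> x + y \<in> carrier (free_algebra X)"
  using keys_add[of x y] by (auto simp: free_algebra_carrier_iff)

lemma free_algebra_sum_closed [simp]:
  "(\<And>i. i \<in> J \<Longrightarrow> f i \<in> carrier (free_algebra X)) \<Longrightarrow> sum f J \<in> carrier (free_algebra X)"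
  by (induction J rule: infinite_finite_induct) auto

lemma free_algebra_mult_closed [simp]:
  "\<lbrakk>x \<in> carrier (free_algebra X); y \<in> carrier (free_algebra X)\<rbrakk> \<Longrightarrow> x * y \<in> carrier (free_algebra X)"
  using keys_mult[of x y] by (fastforce simp: free_algebra_carrier_iff plus_free_monoid_eq_0_iff)

lemma free_algebra_smult_closed [simp]:
  "x \<in> carrier (free_algebra X) \<Longrightarrow> Poly_Mapping.single 0 c * x \<in> carrier (free_algebra X)"
  using keys_mult[of "Poly_Mapping.single 0 c" x]
  by (fastforce simp: free_algebra_carrier_iff split: if_splits)

lemma free_algebra_uminus_closed [simp]:
  fixes x :: "'x free_monoid \<Rightarrow>\<^sub>0 'k::field"
  shows "x \<in> carrier (free_algebra X) \<Longrightarrow> - x \<in> carrier (free_algebra X)"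
  by (simp add: free_algebra_carrier_iff in_keys_iff)

lemma free_algebra_diff_closed [simp]:
  fixes x y :: "'x free_monoid \<Rightarrow>\<^sub>0 'k::field"
  shows "\<lbrakk>x \<in> carrier (free_algebra X); y \<in> carrier (free_algebra X)\<rbrakk> \<Longrightarrow> x - y \<in> carrier (free_algebra X)"
  using free_algebra_add_closed[of x X "- y"] by simp

lemma free_algebra_single_closed:
  "\<lbrakk>w \<noteq> 0; set (letters w) \<subseteq> X\<rbrakk> \<Longrightarrow> Poly_Mapping.single w c \<in> carrier (free_algebra X)"
  by (simp add: free_algebra_carrier_iff)

lemma letter_closed: "x \<in> X \<Longrightarrow> letter x \<in> carrier (free_algebra X)"
  by (simp add: letter_def free_algebra_single_closed zero_free_monoid_def)

section \<open>The quotient by the ideal of relations, computed on representatives\<close>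

locale presented_algebra =
  fixes X :: "'x set" and S :: "('x free_monoid \<Rightarrow>\<^sub>0 'k::field) set"
  assumes relations_closed: "S \<subseteq> carrier (free_algebra X)"
begin

abbreviation A :: "('k, 'x free_monoid \<Rightarrow>\<^sub>0 'k) module" where "A \<equiv> free_algebra X"

abbreviation I :: "('x free_monoid \<Rightarrow>\<^sub>0 'k) set" where "I \<equiv> algebra_ideal A S"

abbreviation Q :: "('k, ('x free_monoid \<Rightarrow>\<^sub>0 'k) set) module" where "Q \<equiv> quotient_algebra A I"

abbreviation cls :: "('x free_monoid \<Rightarrow>\<^sub>0 'k) \<Rightarrow> ('x free_monoid \<Rightarrow>\<^sub>0 'k) set" where
  "cls x \<equiv> I +>\<^bsub>A\<^esub> x"

lemma ideal_subset: "x \<in> I \<Longrightarrow> x \<in> carrier A"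
  by (induction rule: algebra_ideal.induct) (use relations_closed in auto)

lemma zero_in_ideal [simp]: "0 \<in> I"
  using ideal_zero[of A S] by simp

lemma add_in_ideal: "\<lbrakk>x \<in> I; y \<in> I\<rbrakk> \<Longrightarrow> x + y \<in> I"
  using ideal_add[of x A S y] by simp

lemma smult_in_ideal: "x \<in> I \<Longrightarrow> Poly_Mapping.single 0 c * x \<in> I"
  using ideal_smult[of x A S c] by simp

lemma lmult_in_ideal: "\<lbrakk>a \<in> carrier A; x \<in> I\<rbrakk> \<Longrightarrow> a * x \<in> I"
  using ideal_lmult[of a A x S] by simp

lemma rmult_in_ideal: "\<lbrakk>x \<in> I; a \<in> carrier A\<rbrakk> \<Longrightarrow> x * a \<in> I"
  using ideal_rmult[of x A S a] by simp

lemma uminus_in_ideal: "x \<in> I \<Longrightarrow> - x \<in> I"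
  using smult_in_ideal[of x "- 1"] by (simp add: single_uminus)

lemma diff_in_ideal: "\<lbrakk>x \<in> I; y \<in> I\<rbrakk> \<Longrightarrow> x - y \<in> I"
  using add_in_ideal[of x "- y"] uminus_in_ideal[of y] by simp

lemma sum_in_ideal: "(\<And>i. i \<in> J \<Longrightarrow> f i \<in> I) \<Longrightarrow> sum f J \<in> I"
  by (induction J rule: infinite_finite_induct) (auto intro: add_in_ideal)

lemma cls_eq: "cls x = {y. y - x \<in> I}"
proof -
  have "y \<in> (\<lambda>i. i + x) ` I" if "y - x \<in> I" for y
    by (rule image_eqI[OF _ that]) simp
  then show ?thesis by (auto simp: a_r_coset_def')
qed

text \<open>The ideal is closed under sums and differences in the ambient ring, so the usual coset
  criterion holds for arbitrary representatives there.\<close>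

lemma cls_eq_iff: "cls x = cls y \<longleftrightarrow> x - y \<in> I"
proof
  assume "cls x = cls y"
  moreover have "x \<in> cls x" by (simp add: cls_eq)
  ultimately have "x \<in> cls y" by simp
  then show "x - y \<in> I" by (simp add: cls_eq)
next
  assume xy: "x - y \<in> I"
  have "z - x \<in> I \<longleftrightarrow> z - y \<in> I" for z
    using add_in_ideal[OF _ xy, of "z - x"] diff_in_ideal[OF _ xy, of "z - y"] by auto
  then show "cls x = cls y" by (simp add: cls_eq)
qed

lemma cls_eq_zero_iff: "cls x = cls 0 \<longleftrightarrow> x \<in> I"
  by (simp add: cls_eq_iff)

lemma cls_zero: "cls 0 = I"
  by (simp add: cls_eq)

lemma quotient_zero [simp]: "\<zero>\<^bsub>Q\<^esub> = cls 0"
  by (simp add: quotient_algebra_def cls_zero)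

lemma quotient_carrier: "carrier Q = cls ` carrier A"
  by (auto simp: quotient_algebra_def A_RCOSETS_def')

lemma cls_closed [simp]: "x \<in> carrier A \<Longrightarrow> cls x \<in> carrier Q"
  by (simp add: quotient_carrier)

lemma cls_add [simp]: "cls x \<oplus>\<^bsub>Q\<^esub> cls y = cls (x + y)"
proof -
  have "u + v - (x + y) \<in> I" if "u - x \<in> I" "v - y \<in> I" for u v
    using add_in_ideal[OF that] by (simp add: algebra_simps)
  \<comment> \<open>An element \<open>z\<close> of the coset of \<open>x + y\<close> splits as
    \<open>(z - y) + y\<close>, with summands in the cosets of \<open>x\<close> and
    \<open>y\<close>.\<close>
  moreover have "\<exists>u. u - x \<in> I \<and> (\<exists>v. v - y \<in> I \<and> z = u + v)" if "z - (x + y) \<in> I" for z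
    using that by (intro exI[of _ "z - y"] conjI exI[of _ y]) (simp_all add: algebra_simps)
  ultimately show ?thesis
    by (auto simp: quotient_algebra_def set_add_def' cls_eq)
qed

text \<open>The difference telescopes as \<open>(x - x') * y + x' * (y - y')\<close>. The ideal
  absorbs only multipliers from the carrier, which is why membership is asked of \<open>y\<close>
  and \<open>x'\<close>.\<close>

lemma mult_cong:
  assumes "x - x' \<in> I" "y - y' \<in> I" "x' \<in> carrier A" "y \<in> carrier A"
  shows "x * y - x' * y' \<in> I"
proof -
  have "(x - x') * y + x' * (y - y') \<in> I"
    using assms by (intro add_in_ideal rmult_in_ideal lmult_in_ideal)
  then show ?thesis by (simp add: algebra_simps)
qed

text \<open>\<open>rcoset_mult\<close> is a union of cosets over all pairs of representatives. By
  \<open>mult_cong\<close> these cosets coincide, and \<open>x\<close>, \<open>y\<close> themselves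
  show that the union is not empty.\<close>

lemma cls_mult [simp]:
  assumes "x \<in> carrier A" "y \<in> carrier A"
  shows "cls x \<otimes>\<^bsub>Q\<^esub> cls y = cls (x * y)"
proof -
  have "cls (u * v) = cls (x * y)" if "u - x \<in> I" "v - y \<in> I" for u v
  proof -
    \<comment> \<open>The right factor \<open>v\<close> is the sum of \<open>v - y\<close>, in the
      ideal, and \<open>y\<close>; \<open>mult_cong\<close> needs it in the carrier.\<close>
    have "v \<in> carrier A"
      using free_algebra_add_closed[OF ideal_subset[OF that(2)] assms(2)] by simp
    then show ?thesis
      using that assms by (auto simp: cls_eq_iff intro: mult_cong)
  qed
  moreover have "x - x \<in> I" "y - y \<in> I" by simp_all
  ultimately have "(\<Union>u\<in>{u. u - x \<in> I}. \<Union>v\<in>{v. v - y \<in> I}. cls (u * v)) = cls (x * y)"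
    by blast
  then show ?thesis
    by (simp add: quotient_algebra_def rcoset_mult_def cls_eq)
qed

lemma cls_smult [simp]: "c \<odot>\<^bsub>Q\<^esub> cls x = cls (Poly_Mapping.single 0 c * x)"
proof -
  have "cls (Poly_Mapping.single 0 c * u) = cls (Poly_Mapping.single 0 c * x)" if "u - x \<in> I" for u
    using smult_in_ideal[OF that, of c] by (simp add: cls_eq_iff algebra_simps)
  moreover have "x - x \<in> I" by simp
  ultimately have "(\<Union>u\<in>{u. u - x \<in> I}. cls (Poly_Mapping.single 0 c * u))
      = cls (Poly_Mapping.single 0 c * x)"
    by blast
  then show ?thesis
    by (simp add: quotient_algebra_def cls_eq)
qed

lemma quotient_abelian_group: "abelian_group Q"
proof (rule abelian_groupI)
  fix x assume "x \<in> carrier Q"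
  then obtain u where u: "u \<in> carrier A" "x = cls u" by (auto simp: quotient_carrier)
  show "\<exists>y\<in>carrier Q. y \<oplus>\<^bsub>Q\<^esub> x = \<zero>\<^bsub>Q\<^esub>"
    by (rule bexI[of _ "cls (- u)"]) (use u in auto)
qed (auto simp: quotient_carrier ac_simps)

sublocale quotient: abelian_group Q
  by (rule quotient_abelian_group)

lemma finsum_cls:
  assumes "\<And>i. i \<in> J \<Longrightarrow> f i \<in> carrier A"
  shows "(\<Oplus>\<^bsub>Q\<^esub>i\<in>J. cls (f i)) = cls (sum f J)"
  using assms
proof (induction J rule: infinite_finite_induct)
  case (insert i J)
  then have "(\<Oplus>\<^bsub>Q\<^esub>i\<in>insert i J. cls (f i)) = cls (f i) \<oplus>\<^bsub>Q\<^esub> (\<Oplus>\<^bsub>Q\<^esub>i\<in>J. cls (f i))"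
    by (intro quotient.finsum_insert) auto
  then show ?case using insert by simp
qed simp_all

lemma cls_mult_cong:
  assumes "cls x = cls x'" "cls y = cls y'"
    and "x \<in> carrier A" "x' \<in> carrier A" "y \<in> carrier A" "y' \<in> carrier A"
  shows "cls (x * y) = cls (x' * y')"
  using assms by (simp flip: cls_mult)

lemma cls_relation: "x - y \<in> S \<Longrightarrow> cls x = cls y"
  unfolding cls_eq_iff by (rule ideal_base)

lemma cls_sum_in_span:
  "(\<And>i. i \<in> J \<Longrightarrow> cls (f i) \<in> linear_span Q T) \<Longrightarrow> cls (sum f J) \<in> linear_span Q T"
  using linear_span.span_zero[of Q T]
proof (induction J rule: infinite_finite_induct)
  case (insert i J)
  then show ?case using linear_span.span_add[of "cls (f i)" Q T "cls (sum f J)"] by simp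
qed simp_all

text \<open>Spans in the quotient can be computed in the free algebra, so membership in a span
  becomes congruence to an element of a span of representatives.\<close>

lemma linear_span_cls: "linear_span Q (cls ` T) = cls ` linear_span A T"
proof
  show "linear_span Q (cls ` T) \<subseteq> cls ` linear_span A T"
  proof
    fix x assume "x \<in> linear_span Q (cls ` T)"
    then show "x \<in> cls ` linear_span A T"
    proof (induction rule: linear_span.induct)
      case span_zero
      show ?case using linear_span.span_zero[of A T] by auto
    next
      case (span_base x)
      then show ?case by (auto intro: linear_span.span_base)
    next
      case (span_add x y)
      then obtain u v where "u \<in> linear_span A T" "v \<in> linear_span A T" "x = cls u" "y = cls v"
        by auto
      then show ?case using linear_span.span_add[of u A T v] by auto
    next
      case (span_smult x c)
      then obtain u where "u \<in> linear_span A T" "x = cls u" by auto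
      then show ?case using linear_span.span_smult[of u A T c] by auto
    qed
  qed
  have "cls x \<in> linear_span Q (cls ` T)" if "x \<in> linear_span A T" for x
    using that
  proof (induction rule: linear_span.induct)
    case span_zero
    show ?case using linear_span.span_zero[of Q] by simp
  next
    case (span_base x)
    then show ?case by (auto intro: linear_span.span_base)
  next
    case (span_add x y)
    then show ?case using linear_span.span_add[of "cls x" Q _ "cls y"] by simp
  next
    case (span_smult x c)
    then show ?case using linear_span.span_smult[of "cls x" Q _ c] by simp
  qed
  then show "cls ` linear_span A T \<subseteq> linear_span Q (cls ` T)" by auto
qed

end

section \<open>Gradings by homogeneous relations\<close>

locale graded_generators = group G for G (structure) +
  fixes X :: "'x set" and \<delta> :: "'x \<Rightarrow> 'a"
  assumes letter_degree_closed [simp]: "\<delta> x \<in> carrier G"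
begin

text \<open>The monoid homomorphism from words to the group that extends
  \<open>\<delta>\<close>.\<close>

definition word_degree :: "'x free_monoid \<Rightarrow> 'a" where
  "word_degree w = foldr (\<lambda>x h. \<delta> x \<otimes> h) (letters w) \<one>"

lemma foldr_degree_closed [simp]: "foldr (\<lambda>x h. \<delta> x \<otimes> h) xs \<one> \<in> carrier G"
  by (induction xs) auto

lemma word_degree_closed [simp]: "word_degree w \<in> carrier G"
  by (simp add: word_degree_def)

lemma word_degree_plus: "word_degree (u + w) = word_degree u \<otimes> word_degree w"
proof -
  have "foldr (\<lambda>x h. \<delta> x \<otimes> h) (xs @ ys) \<one> =
      foldr (\<lambda>x h. \<delta> x \<otimes> h) xs \<one> \<otimes> foldr (\<lambda>x h. \<delta> x \<otimes> h) ys \<one>" for xs ys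
    by (induction xs) (auto simp: m_assoc simp del: foldr_append)
  then show ?thesis by (simp add: word_degree_def del: foldr_append)
qed

definition component :: "'a \<Rightarrow> ('x free_monoid \<Rightarrow>\<^sub>0 'k::field) \<Rightarrow> ('x free_monoid \<Rightarrow>\<^sub>0 'k::field)" where
  "component g = Poly_Mapping.mapp (\<lambda>w c. c when word_degree w = g)"

definition homogeneous_part :: "'a \<Rightarrow> ('x free_monoid \<Rightarrow>\<^sub>0 'k::field) set" where
  "homogeneous_part g = {x \<in> carrier (free_algebra X). \<forall>w\<in>Poly_Mapping.keys x. word_degree w = g}"

lemma lookup_component:
  "Poly_Mapping.lookup (component g x) w = (Poly_Mapping.lookup x w when word_degree w = g)"
  by (simp add: component_def lookup_mapp when_def in_keys_iff)

lemma component_zero [simp]: "component g 0 = 0"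
  by (rule poly_mapping_eqI) (simp add: lookup_component)

lemma component_add: "component g (x + y) = component g x + component g y"
  by (rule poly_mapping_eqI) (simp add: lookup_component lookup_add when_add_distrib)

lemma component_diff: "component g (x - y) = component g x - component g y"
  by (rule poly_mapping_eqI) (simp add: lookup_component lookup_minus when_diff_distrib)

lemma component_sum: "component g (sum f J) = (\<Sum>i\<in>J. component g (f i))"
  by (induction J rule: infinite_finite_induct) (simp_all add: component_add)

lemma component_single:
  "component g (Poly_Mapping.single w c) = (if word_degree w = g then Poly_Mapping.single w c else 0)"
  by (rule poly_mapping_eqI) (auto simp: lookup_component lookup_single when_def)

text \<open>Multiplication by a word on the left translates degrees: a word \<open>u\<close> of
  \<open>x\<close> ends up in degree \<open>g\<close> exactly when its own degree is
  \<open>inv (word_degree w) \<otimes> g\<close>. Linearity reduces the claim to monomials.\<close>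

lemma component_single_mult:
  assumes "g \<in> carrier G"
  shows "component g (Poly_Mapping.single w c * x)
    = Poly_Mapping.single w c * component (inv (word_degree w) \<otimes> g) x"
proof -
  have *: "word_degree w \<otimes> word_degree u = g \<longleftrightarrow> word_degree u = inv (word_degree w) \<otimes> g" for u
    using assms by (metis inv_solve_left' word_degree_closed)
  show ?thesis
    by (subst (1 2) poly_mapping_expansion[of x])
      (simp add: sum_distrib_left component_sum mult_single component_single word_degree_plus *
        if_distrib[of "(*) _"] cong: if_cong)
qed

lemma component_mult_single:
  assumes "g \<in> carrier G"
  shows "component g (x * Poly_Mapping.single w c)
    = component (g \<otimes> inv (word_degree w)) x * Poly_Mapping.single w c"
proof -
  have *: "word_degree u \<otimes> word_degree w = g \<longleftrightarrow> word_degree u = g \<otimes> inv (word_degree w)" for u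
    using assms by (metis inv_solve_right' word_degree_closed)
  show ?thesis
    by (subst (1 2) poly_mapping_expansion[of x])
      (simp add: sum_distrib_right component_sum mult_single component_single word_degree_plus *
        if_distrib[of "\<lambda>y. y * _"] cong: if_cong)
qed

lemma keys_component: "Poly_Mapping.keys (component g x) = {w \<in> Poly_Mapping.keys x. word_degree w = g}"
  by (auto simp: in_keys_iff lookup_component when_def split: if_splits)

lemma component_in_homogeneous_part: "x \<in> carrier (free_algebra X) \<Longrightarrow> component g x \<in> homogeneous_part g"
  by (auto simp: homogeneous_part_def free_algebra_carrier_iff keys_component)

lemma component_homogeneous:
  assumes "x \<in> homogeneous_part h"
  shows "component g x = (if h = g then x else 0)"
  using assms
  by (intro poly_mapping_eqI) (auto simp: lookup_component homogeneous_part_def when_def in_keys_iff)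

lemma component_eq_zero: "g \<notin> word_degree ` Poly_Mapping.keys x \<Longrightarrow> component g x = 0"
  by (intro poly_mapping_eqI) (auto simp: lookup_component when_def in_keys_iff)

text \<open>Each word contributes to the component of its own degree alone, so any finite set
  containing all occurring degrees recovers \<open>x\<close>.\<close>

lemma sum_components:
  assumes "finite J" "word_degree ` Poly_Mapping.keys x \<subseteq> J"
  shows "(\<Sum>g\<in>J. component g x) = x"
proof (rule poly_mapping_eqI)
  fix w
  have "Poly_Mapping.lookup (\<Sum>g\<in>J. component g x) w
      = (\<Sum>g\<in>J. if g = word_degree w then Poly_Mapping.lookup x w else 0)"
    unfolding lookup_sum by (rule sum.cong) (auto simp: lookup_component when_def)
  also have "\<dots> = Poly_Mapping.lookup x w"
    using assms by (auto simp flip: not_in_keys_iff_lookup_eq_zero)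
  finally show "Poly_Mapping.lookup (\<Sum>g\<in>J. component g x) w = Poly_Mapping.lookup x w" .
qed

lemma homogeneous_part_subset: "x \<in> homogeneous_part g \<Longrightarrow> x \<in> carrier (free_algebra X)"
  by (simp add: homogeneous_part_def)

lemma homogeneous_part_zero: "0 \<in> homogeneous_part g"
  by (simp add: homogeneous_part_def)

lemma homogeneous_part_add:
  "\<lbrakk>x \<in> homogeneous_part g; y \<in> homogeneous_part g\<rbrakk> \<Longrightarrow> x + y \<in> homogeneous_part g"
  using keys_add[of x y] by (auto simp: homogeneous_part_def)

lemma homogeneous_part_sum:
  "(\<And>i. i \<in> J \<Longrightarrow> f i \<in> homogeneous_part g) \<Longrightarrow> sum f J \<in> homogeneous_part g"
  by (induction J rule: infinite_finite_induct) (simp_all add: homogeneous_part_zero homogeneous_part_add)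

lemma homogeneous_part_uminus: "x \<in> homogeneous_part g \<Longrightarrow> - x \<in> homogeneous_part g"
  by (auto simp: homogeneous_part_def in_keys_iff)

lemma homogeneous_part_diff:
  "\<lbrakk>x \<in> homogeneous_part g; y \<in> homogeneous_part g\<rbrakk> \<Longrightarrow> x - y \<in> homogeneous_part g"
  using homogeneous_part_add[of x g "- y"] homogeneous_part_uminus[of y g] by simp

lemma letter_homogeneous: "x \<in> X \<Longrightarrow> letter x \<in> homogeneous_part (\<delta> x)"
  using letter_closed[of x X] by (simp add: homogeneous_part_def letter_def word_degree_def)

lemma homogeneous_part_mult:
  "\<lbrakk>x \<in> homogeneous_part g; y \<in> homogeneous_part h\<rbrakk> \<Longrightarrow> x * y \<in> homogeneous_part (g \<otimes> h)"
  using keys_mult[of x y] by (auto simp: homogeneous_part_def word_degree_plus)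

lemma homogeneous_part_smult:
  "x \<in> homogeneous_part g \<Longrightarrow> Poly_Mapping.single 0 c * x \<in> homogeneous_part g"
  using keys_mult[of "Poly_Mapping.single 0 c" x]
  by (auto simp: homogeneous_part_def split: if_splits)

end

section \<open>Descent of the grading to the quotient by homogeneous relations\<close>

locale graded_presentation = presented_algebra X S + graded_generators G X \<delta>
  for X :: "'x set" and S :: "('x free_monoid \<Rightarrow>\<^sub>0 'k::field) set" and G (structure) and \<delta> +
  assumes relations_homogeneous: "r \<in> S \<Longrightarrow> \<exists>g. r \<in> homogeneous_part g"
begin

text \<open>An ideal generated by homogeneous elements is homogeneous. The induction follows the
  generation of the ideal and keeps \<open>g\<close> arbitrary, because multiplying by a word
  changes the degree in which the component of \<open>x\<close> is taken.\<close>

lemma component_in_ideal: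
  assumes "x \<in> I" "g \<in> carrier G"
  shows "component g x \<in> I"
  using assms
proof (induction arbitrary: g rule: algebra_ideal.induct)
  case (ideal_base x)
  obtain h where "x \<in> homogeneous_part h"
    using relations_homogeneous[OF ideal_base(1)] by auto
  then show ?case
    using ideal_base by (simp add: component_homogeneous algebra_ideal.ideal_base)
next
  case (ideal_smult x c)
  \<comment> \<open>A scalar acts through the empty word, of degree \<open>\<one>\<close>, and so
    does not shift components.\<close>
  have "word_degree 0 = \<one>" by (simp add: word_degree_def zero_free_monoid_def)
  then show ?case using ideal_smult by (simp add: component_single_mult smult_in_ideal)
next
  case (ideal_lmult a x)
  \<comment> \<open>Splitting the multiplier into monomials gives one translation of degree per
    word; each monomial is again in the carrier, so the ideal absorbs it.\<close>
  have "component g (a * x) = (\<Sum>w\<in>Poly_Mapping.keys a.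
      Poly_Mapping.single w (Poly_Mapping.lookup a w) * component (inv (word_degree w) \<otimes> g) x)"
    using ideal_lmult.prems
    by (subst poly_mapping_expansion[of a])
      (simp add: sum_distrib_right component_sum component_single_mult)
  also have "\<dots> \<in> I"
    using ideal_lmult
    by (intro sum_in_ideal lmult_in_ideal) (auto simp: free_algebra_carrier_iff)
  finally show ?case by simp
next
  case (ideal_rmult x a)
  have "component g (x * a) = (\<Sum>w\<in>Poly_Mapping.keys a.
      component (g \<otimes> inv (word_degree w)) x * Poly_Mapping.single w (Poly_Mapping.lookup a w))"
    using ideal_rmult.prems
    by (subst poly_mapping_expansion[of a])
      (simp add: sum_distrib_left component_sum component_mult_single)
  also have "\<dots> \<in> I"
    using ideal_rmult
    by (intro sum_in_ideal rmult_in_ideal) (auto simp: free_algebra_carrier_iff)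
  finally show ?case by simp
qed (simp_all add: component_add add_in_ideal)

lemma additive_subgroup_homogeneous_part:
  "additive_subgroup (cls ` homogeneous_part g) Q"
proof (rule additive_subgroup.intro, rule quotient.add.subgroupI)
  show "cls ` homogeneous_part g \<subseteq> carrier Q"
    by (auto dest: homogeneous_part_subset)
  show "cls ` homogeneous_part g \<noteq> {}"
    using homogeneous_part_zero by auto
next
  fix x assume "x \<in> cls ` homogeneous_part g"
  then obtain u where u: "u \<in> homogeneous_part g" "x = cls u" by auto
  have "\<ominus>\<^bsub>Q\<^esub> x = cls (- u)"
    using u by (intro quotient.minus_equality) (auto dest: homogeneous_part_subset)
  then show "\<ominus>\<^bsub>Q\<^esub> x \<in> cls ` homogeneous_part g"
    using homogeneous_part_uminus[OF u(1)] by simp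
next
  fix x y assume "x \<in> cls ` homogeneous_part g" "y \<in> cls ` homogeneous_part g"
  then show "x \<oplus>\<^bsub>Q\<^esub> y \<in> cls ` homogeneous_part g"
    by (auto intro: homogeneous_part_add)
qed

text \<open>The components of a representative supply the decomposition. Some of them may be nonzero
  and still vanish in the quotient, so the support of \<open>F\<close> can be smaller than the set
  of degrees occurring in \<open>x\<close>.\<close>

lemma homogeneous_decomposition_ex:
  assumes x: "x \<in> carrier A"
  defines "F \<equiv> \<lambda>g\<in>carrier G. cls (component g x)"
  shows "F \<in> (\<Pi>\<^sub>E g\<in>carrier G. cls ` homogeneous_part g)"
    and "finite {g \<in> carrier G. F g \<noteq> \<zero>\<^bsub>Q\<^esub>}"
    and "cls x = (\<Oplus>\<^bsub>Q\<^esub>g\<in>{g \<in> carrier G. F g \<noteq> \<zero>\<^bsub>Q\<^esub>}. F g)"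
proof -
  let ?J = "word_degree ` Poly_Mapping.keys x" and ?supp = "{g \<in> carrier G. F g \<noteq> \<zero>\<^bsub>Q\<^esub>}"
  have sub: "?supp \<subseteq> ?J"
    using component_eq_zero[of _ x] by (auto simp: F_def)
  show "F \<in> (\<Pi>\<^sub>E g\<in>carrier G. cls ` homogeneous_part g)"
    using x by (auto simp: F_def component_in_homogeneous_part)
  show fin: "finite ?supp"
    by (rule finite_subset[OF sub]) simp
  have cc: "component g x \<in> carrier A" for g
    using component_in_homogeneous_part[OF x] homogeneous_part_subset by blast
  have "(\<Oplus>\<^bsub>Q\<^esub>g\<in>?supp. F g) = (\<Oplus>\<^bsub>Q\<^esub>g\<in>?supp. cls (component g x))"
    by (rule quotient.finsum_cong') (auto simp: F_def cc)
  also have "\<dots> = cls (\<Sum>g\<in>?supp. component g x)"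
    by (rule finsum_cls) (rule cc)
  also have "\<dots> = cls (\<Sum>g\<in>?J. component g x)"
  proof -
    \<comment> \<open>Degrees of \<open>x\<close> missing from the support are those whose component
      has class zero, that is, lies in the ideal; dropping them leaves the class of the sum
      unchanged.\<close>
    have "component g x \<in> I" if "g \<in> ?J - ?supp" for g
      using that by (auto simp: F_def cls_eq_zero_iff)
    then have "(\<Sum>g\<in>?J - ?supp. component g x) \<in> I"
      by (rule sum_in_ideal)
    moreover have "(\<Sum>g\<in>?J. component g x) = (\<Sum>g\<in>?J - ?supp. component g x) + (\<Sum>g\<in>?supp. component g x)"
      by (rule sum.subset_diff[OF sub]) simp
    ultimately show ?thesis
      by (simp add: cls_eq_iff uminus_in_ideal)
  qed
  also have "\<dots> = cls x" by (simp add: sum_components)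
  finally show "cls x = (\<Oplus>\<^bsub>Q\<^esub>g\<in>?supp. F g)" by simp
qed

text \<open>Homogeneous representatives \<open>y g\<close> of the values of \<open>F\<close> add up
  to \<open>x\<close> modulo the ideal. Since the ideal is homogeneous, taking components of this
  congruence determines each \<open>F g\<close>.\<close>

lemma homogeneous_decomposition_unique:
  assumes x: "x \<in> carrier A"
    and F: "F \<in> (\<Pi>\<^sub>E g\<in>carrier G. cls ` homogeneous_part g)"
    and fin: "finite {g \<in> carrier G. F g \<noteq> \<zero>\<^bsub>Q\<^esub>}"
    and sum: "cls x = (\<Oplus>\<^bsub>Q\<^esub>g\<in>{g \<in> carrier G. F g \<noteq> \<zero>\<^bsub>Q\<^esub>}. F g)"
  shows "F = (\<lambda>g\<in>carrier G. cls (component g x))"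
proof -
  let ?supp = "{g \<in> carrier G. F g \<noteq> \<zero>\<^bsub>Q\<^esub>}"
  have "\<forall>g\<in>carrier G. \<exists>y. y \<in> homogeneous_part g \<and> F g = cls y"
    using F by (fastforce simp: PiE_iff)
  then obtain y where y: "\<And>g. g \<in> carrier G \<Longrightarrow> y g \<in> homogeneous_part g"
      "\<And>g. g \<in> carrier G \<Longrightarrow> F g = cls (y g)"
    by metis
  have yc: "g \<in> carrier G \<Longrightarrow> y g \<in> carrier A" for g
    using y(1) homogeneous_part_subset by blast
  have "cls x = (\<Oplus>\<^bsub>Q\<^esub>g\<in>?supp. cls (y g))"
    unfolding sum by (rule quotient.finsum_cong') (auto simp: y(2) yc)
  also have "\<dots> = cls (sum y ?supp)"
    by (rule finsum_cls) (simp add: yc)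
  finally have xI: "x - sum y ?supp \<in> I" by (simp add: cls_eq_iff)
  have "F g = cls (component g x)" if g: "g \<in> carrier G" for g
  proof -
    \<comment> \<open>Only the summand of degree \<open>g\<close> survives. If \<open>g\<close> is
      outside the support the result is \<open>0\<close>, which still represents
      \<open>F g\<close>.\<close>
    have "component g (sum y ?supp) = (\<Sum>h\<in>?supp. if h = g then y g else 0)"
      unfolding component_sum
      by (rule sum.cong) (auto simp: component_homogeneous[OF y(1)])
    also have "\<dots> = (if g \<in> ?supp then y g else 0)" using fin by simp
    finally have "component g (sum y ?supp) = (if g \<in> ?supp then y g else 0)" .
    then have "cls (component g (sum y ?supp)) = F g"
      using g y(2) by auto
    moreover have "cls (component g x) = cls (component g (sum y ?supp))"
      unfolding cls_eq_iff component_diff[symmetric] by (rule component_in_ideal[OF xI g])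
    ultimately show ?thesis by simp
  qed
  then show ?thesis
    using F by (intro extensionalityI[of F "carrier G"]) (auto simp: PiE_iff)
qed

theorem grading_by_homogeneous_parts: "is_grading G Q (\<lambda>g. cls ` homogeneous_part g)"
  unfolding is_grading_def
proof (intro conjI ballI)
  show "additive_subgroup (cls ` homogeneous_part g) Q" for g
    by (rule additive_subgroup_homogeneous_part)
next
  fix g h x y assume "x \<in> cls ` homogeneous_part g" "y \<in> cls ` homogeneous_part h"
  then show "x \<otimes>\<^bsub>Q\<^esub> y \<in> cls ` homogeneous_part (g \<otimes> h)"
    by (auto simp: homogeneous_part_subset homogeneous_part_mult)
next
  fix r assume "r \<in> carrier Q"
  then obtain x where x: "x \<in> carrier A" "r = cls x" by (auto simp: quotient_carrier)
  show "\<exists>!f. f \<in> (\<Pi>\<^sub>E g\<in>carrier G. cls ` homogeneous_part g) \<and>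
      finite {g \<in> carrier G. f g \<noteq> \<zero>\<^bsub>Q\<^esub>} \<and> r = (\<Oplus>\<^bsub>Q\<^esub>g\<in>{g \<in> carrier G. f g \<noteq> \<zero>\<^bsub>Q\<^esub>}. f g)"
    unfolding x(2)
  proof (rule ex1I)
    show "(\<lambda>g\<in>carrier G. cls (component g x)) \<in> (\<Pi>\<^sub>E g\<in>carrier G. cls ` homogeneous_part g) \<and>
      finite {g \<in> carrier G. (\<lambda>g\<in>carrier G. cls (component g x)) g \<noteq> \<zero>\<^bsub>Q\<^esub>} \<and>
      cls x = (\<Oplus>\<^bsub>Q\<^esub>g\<in>{g \<in> carrier G. (\<lambda>g\<in>carrier G. cls (component g x)) g \<noteq> \<zero>\<^bsub>Q\<^esub>}.
        (\<lambda>g\<in>carrier G. cls (component g x)) g)"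
      by (intro conjI homogeneous_decomposition_ex[OF x(1)])
  qed (use homogeneous_decomposition_unique[OF x(1)] in blast)
qed

text \<open>A criterion for \<open>T\<close> to span: words are built up from the left, one letter
  at a time. \<open>letter\<close> starts the induction, as words in the carrier are nonempty, and
  \<open>step\<close> rewrites a spanning element times a letter in the correct degree. The converse
  inclusion is \<open>hom\<close>.\<close>

lemma homogeneous_part_eq_span:
  assumes hom: "\<And>g. g \<in> carrier G \<Longrightarrow> T g \<subseteq> homogeneous_part g"
    and letter: "\<And>x. x \<in> X \<Longrightarrow> cls (letter x) \<in> linear_span Q (cls ` T (\<delta> x))"
    and step: "\<And>g t x. \<lbrakk>g \<in> carrier G; t \<in> T g; x \<in> X\<rbrakk>
      \<Longrightarrow> cls (t * letter x) \<in> linear_span Q (cls ` T (g \<otimes> \<delta> x))"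
    and g: "g \<in> carrier G"
  shows "cls ` homogeneous_part g = linear_span Q (cls ` T g)"
proof -
  let ?N = "\<lambda>g. linear_span A (T g)"
  have zero: "0 \<in> ?N g" for g using linear_span.span_zero[of A] by simp
  have add: "x + y \<in> ?N g" if "x \<in> ?N g" "y \<in> ?N g" for g x y
    using linear_span.span_add[OF that] by simp
  have smult: "Poly_Mapping.single 0 c * x \<in> ?N g" if "x \<in> ?N g" for g x c
    using linear_span.span_smult[OF that] by simp
  \<comment> \<open>Extends \<open>step\<close> from \<open>T g\<close> to its span by
    linearity.\<close>
  have step': "\<exists>z\<in>?N (g \<otimes> \<delta> x). t * letter x - z \<in> I"
    if "t \<in> ?N g" "g \<in> carrier G" "x \<in> X" for g t x
    using that(1)
  proof (induction rule: linear_span.induct)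
    case span_zero
    show ?case using zero by (intro bexI[of _ 0]) auto
  next
    case (span_base t)
    then show ?case using step[of g t x] that by (auto simp: linear_span_cls cls_eq_iff)
  next
    case (span_add s t)
    then obtain y z where yz: "y \<in> ?N (g \<otimes> \<delta> x)" "z \<in> ?N (g \<otimes> \<delta> x)"
      "s * letter x - y \<in> I" "t * letter x - z \<in> I" by blast
    show ?case
      using add_in_ideal[OF yz(3,4)] add[OF yz(1,2)]
      by (intro bexI[of _ "y + z"]) (simp_all add: algebra_simps)
  next
    case (span_smult t c)
    then obtain z where z: "z \<in> ?N (g \<otimes> \<delta> x)" "t * letter x - z \<in> I" by blast
    show ?case
      using smult_in_ideal[OF z(2), of c] smult[OF z(1), of c]
      by (intro bexI[of _ "Poly_Mapping.single 0 c * z"]) (simp_all add: algebra_simps)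
  qed
  have word: "\<exists>z\<in>?N (word_degree (Word xs)). Poly_Mapping.single (Word xs) 1 - z \<in> I"
    if "xs \<noteq> []" "set xs \<subseteq> X" for xs
    using that
  proof (induction xs rule: rev_nonempty_induct)
    case (single x)
    then show ?case using letter[of x] by (auto simp: linear_span_cls cls_eq_iff letter_def word_degree_def)
  next
    case (snoc x xs)
    then obtain z where z: "z \<in> ?N (word_degree (Word xs))" "Poly_Mapping.single (Word xs) 1 - z \<in> I"
      by auto
    obtain y where y: "y \<in> ?N (word_degree (Word xs) \<otimes> \<delta> x)" "z * letter x - y \<in> I"
      using step'[OF z(1)] snoc.prems by auto
    have split: "Word (xs @ [x]) = Word xs + Word [x]" by (simp add: plus_free_monoid_def)
    \<comment> \<open>First replace the prefix by its reduction \<open>z\<close>, then reduce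
      \<open>z * letter x\<close> to \<open>y\<close>; the two errors add up to the extended word
      minus \<open>y\<close>.\<close>
    have "(Poly_Mapping.single (Word xs) 1 - z) * letter x + (z * letter x - y) \<in> I"
      using snoc.prems z y by (intro add_in_ideal rmult_in_ideal letter_closed) auto
    then have "Poly_Mapping.single (Word (xs @ [x])) 1 - y \<in> I"
      by (simp add: algebra_simps letter_def mult_single split)
    moreover have "word_degree (Word (xs @ [x])) = word_degree (Word xs) \<otimes> \<delta> x"
      unfolding split word_degree_plus by (simp add: word_degree_def)
    ultimately show ?case using y by auto
  qed
  have "\<exists>z\<in>?N g. x - z \<in> I" if x: "x \<in> homogeneous_part g" for x
  proof -
    have "\<exists>z\<in>?N g. Poly_Mapping.single w 1 - z \<in> I" if "w \<in> Poly_Mapping.keys x" for w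
    proof -
      have "w \<noteq> 0" "set (letters w) \<subseteq> X" "word_degree w = g"
        using that x by (auto simp: homogeneous_part_def free_algebra_carrier_iff)
      then show ?thesis using word[of "letters w"] by (simp add: letters_eq_Nil_iff)
    qed
    then obtain z where z: "\<And>w. w \<in> Poly_Mapping.keys x \<Longrightarrow> z w \<in> ?N g"
      "\<And>w. w \<in> Poly_Mapping.keys x \<Longrightarrow> Poly_Mapping.single w 1 - z w \<in> I"
      by metis
    let ?c = "\<lambda>w. Poly_Mapping.single 0 (Poly_Mapping.lookup x w)"
    have "(\<Sum>w\<in>J. ?c w * z w) \<in> ?N g" if "J \<subseteq> Poly_Mapping.keys x" for J
      using finite_subset[OF that finite_keys] that
      by (induction J rule: finite_induct) (simp_all add: zero add smult z(1))
    moreover have "(\<Sum>w\<in>Poly_Mapping.keys x. ?c w * (Poly_Mapping.single w 1 - z w)) \<in> I"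
      by (intro sum_in_ideal smult_in_ideal z(2))
    then have "(\<Sum>w\<in>Poly_Mapping.keys x. Poly_Mapping.single w (Poly_Mapping.lookup x w)) -
        (\<Sum>w\<in>Poly_Mapping.keys x. ?c w * z w) \<in> I"
      by (simp add: right_diff_distrib mult_single sum_subtractf)
    ultimately show ?thesis
      using poly_mapping_expansion[of x] by auto
  qed
  then have "cls ` homogeneous_part g \<subseteq> cls ` ?N g"
    by (fastforce simp: cls_eq_iff image_iff)
  moreover have "?N g \<subseteq> homogeneous_part g"
  proof
    fix x assume "x \<in> ?N g"
    then show "x \<in> homogeneous_part g"
      by (induction rule: linear_span.induct)
        (use hom[OF g] in \<open>auto intro: homogeneous_part_zero homogeneous_part_add homogeneous_part_smult\<close>)
  qed
  ultimately show ?thesis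
    unfolding linear_span_cls by blast
qed

end

section \<open>The Kumjian--Pask relations\<close>

context k_graph
begin

lemma vertexD:
  assumes "v \<in> vertices \<Lambda>"
  shows "v \<in> mor \<Lambda>" "deg \<Lambda> v = 0" "rng \<Lambda> v = v" "src \<Lambda> v = v"
  using assms unfolding vertices_eq_identities
  by (auto simp: rng_closed rng_rng src_rng deg_rng)

lemma comp_vertex: "v \<in> vertices \<Lambda> \<Longrightarrow> comp \<Lambda> v v = v"
  using comp_rng[of v] by (simp add: vertexD)

lemma rng_in_vertices: "\<alpha> \<in> mor \<Lambda> \<Longrightarrow> rng \<Lambda> \<alpha> \<in> vertices \<Lambda>"
  by (simp add: paths_def rng_closed deg_rng)

lemma src_in_vertices: "\<alpha> \<in> mor \<Lambda> \<Longrightarrow> src \<Lambda> \<alpha> \<in> vertices \<Lambda>"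
  by (simp add: paths_def src_closed deg_src)

lemma paths_at_zero: "v \<in> vertices \<Lambda> \<Longrightarrow> paths_at \<Lambda> v 0 = {v}"
  by (auto simp: paths_at_def vertexD)

lemma paths_atD:
  assumes "\<alpha> \<in> paths_at \<Lambda> v n"
  shows "\<alpha> \<in> mor \<Lambda>" "deg \<Lambda> \<alpha> = n" "rng \<Lambda> \<alpha> = v"
  using assms by (auto simp: paths_at_def paths_def)

lemma fp_closed: "v \<in> vertices \<Lambda> \<Longrightarrow> fp v \<in> carrier (free_algebra (kp_gens \<Lambda>))"
  by (auto simp: fp_def kp_gens_def intro: letter_closed)

lemma fs_closed: "\<alpha> \<in> mor \<Lambda> \<Longrightarrow> fs \<Lambda> \<alpha> \<in> carrier (free_algebra (kp_gens \<Lambda>))"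
  by (auto simp: fs_def fp_def kp_gens_def paths_def intro: letter_closed)

lemma fs_star_closed: "\<alpha> \<in> mor \<Lambda> \<Longrightarrow> fs_star \<Lambda> \<alpha> \<in> carrier (free_algebra (kp_gens \<Lambda>))"
  by (auto simp: fs_star_def fp_def kp_gens_def paths_def intro: letter_closed)

lemma path_sum_closed:
  "(\<Sum>\<alpha>\<in>paths_at \<Lambda> v n. fs \<Lambda> \<alpha> * fs_star \<Lambda> \<alpha>) \<in> carrier (free_algebra (kp_gens \<Lambda>))"
  by (auto intro!: free_algebra_sum_closed free_algebra_mult_closed fs_closed fs_star_closed dest: paths_atD(1))

lemma fs_vertex: "v \<in> vertices \<Lambda> \<Longrightarrow> fs \<Lambda> v = fp v"
  by (simp add: fs_def vertexD)

lemma fs_star_vertex: "v \<in> vertices \<Lambda> \<Longrightarrow> fs_star \<Lambda> v = fp v"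
  by (simp add: fs_star_def vertexD)

end

text \<open>The parameter \<open>K\<close> only fixes the type of scalars, which a
  \<open>k\<close>-graph alone does not determine.\<close>

locale kumjian_pask = k_graph k \<Lambda> for k and \<Lambda> :: "'m kgraph" +
  fixes K :: "'k::field itself"
begin

lemma kp_relations_closed:
  "(kp_relations k \<Lambda> :: ('m kp_gen free_monoid \<Rightarrow>\<^sub>0 'k) set) \<subseteq> carrier (free_algebra (kp_gens \<Lambda>))"
proof
  fix r :: "'m kp_gen free_monoid \<Rightarrow>\<^sub>0 'k"
  assume "r \<in> kp_relations k \<Lambda>"
  then show "r \<in> carrier (free_algebra (kp_gens \<Lambda>))"
    by cases (auto simp: fp_closed fs_closed fs_star_closed comp_closed rng_in_vertices src_in_vertices
        path_sum_closed)
qed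

sublocale presented_algebra "kp_gens \<Lambda>" "kp_relations k \<Lambda> :: ('m kp_gen free_monoid \<Rightarrow>\<^sub>0 'k) set"
  by unfold_locales (rule kp_relations_closed)

section \<open>Calculation rules modulo the relations, including degree zero\<close>

lemma cls_fp_mult:
  assumes "v \<in> vertices \<Lambda>" "w \<in> vertices \<Lambda>"
  shows "cls (fp v * fp w) = cls (if v = w then fp v else 0)"
  using assms KP1_idem[of v \<Lambda> k] KP1_orth[of v \<Lambda> w k]
  by (intro cls_relation) auto

text \<open>(KP2) gives products only for two paths of nonzero degree. If one factor is a vertex,
  the rule is \<open>p_r s = s\<close> or \<open>s p_s = s\<close>, and if both are, it is
  idempotence from (KP1).\<close>

lemma cls_fs_comp:
  assumes "\<alpha> \<in> mor \<Lambda>" "\<beta> \<in> mor \<Lambda>" "src \<Lambda> \<alpha> = rng \<Lambda> \<beta>"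
  shows "cls (fs \<Lambda> \<alpha> * fs \<Lambda> \<beta>) = cls (fs \<Lambda> (comp \<Lambda> \<alpha> \<beta>))"
proof (cases "deg \<Lambda> \<alpha> = 0")
  case True
  then have v: "\<alpha> \<in> vertices \<Lambda>" using assms by (simp add: paths_def)
  then have \<alpha>: "\<alpha> = rng \<Lambda> \<beta>" using assms vertexD by auto
  show ?thesis
  proof (cases "deg \<Lambda> \<beta> = 0")
    case True
    then have "\<beta> \<in> vertices \<Lambda>" using assms by (simp add: paths_def)
    then show ?thesis using \<alpha> cls_fp_mult[of \<beta> \<beta>] assms by (simp add: vertexD fs_vertex comp_vertex)
  next
    case False
    then show ?thesis
      unfolding \<alpha> fs_vertex[OF rng_in_vertices[OF assms(2)]] comp_rng[OF assms(2)]
      by (intro cls_relation KP2_rng assms(2))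
  qed
next
  case \<alpha>: False
  show ?thesis
  proof (cases "deg \<Lambda> \<beta> = 0")
    case True
    then have "\<beta> \<in> vertices \<Lambda>" using assms by (simp add: paths_def)
    then have \<beta>: "\<beta> = src \<Lambda> \<alpha>" using assms(3) by (simp add: vertexD)
    show ?thesis
      unfolding \<beta> fs_vertex[OF src_in_vertices[OF assms(1)]] comp_src[OF assms(1)]
      by (intro cls_relation KP2_src assms(1) \<alpha>)
  next
    case False
    then show ?thesis
      using \<alpha> assms by (intro cls_relation KP2_comp)
  qed
qed

lemma cls_fs_star_comp:
  assumes "\<alpha> \<in> mor \<Lambda>" "\<beta> \<in> mor \<Lambda>" "src \<Lambda> \<alpha> = rng \<Lambda> \<beta>"
  shows "cls (fs_star \<Lambda> \<beta> * fs_star \<Lambda> \<alpha>) = cls (fs_star \<Lambda> (comp \<Lambda> \<alpha> \<beta>))"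
proof (cases "deg \<Lambda> \<alpha> = 0")
  case True
  then have v: "\<alpha> \<in> vertices \<Lambda>" using assms by (simp add: paths_def)
  then have \<alpha>: "\<alpha> = rng \<Lambda> \<beta>" using assms vertexD by auto
  show ?thesis
  proof (cases "deg \<Lambda> \<beta> = 0")
    case True
    then have "\<beta> \<in> vertices \<Lambda>" using assms by (simp add: paths_def)
    then show ?thesis using \<alpha> cls_fp_mult[of \<beta> \<beta>] assms by (simp add: vertexD fs_star_vertex comp_vertex)
  next
    case False
    then show ?thesis
      unfolding \<alpha> fs_star_vertex[OF rng_in_vertices[OF assms(2)]] comp_rng[OF assms(2)]
      by (intro cls_relation KP2_rng_star assms(2))
  qed
next
  case \<alpha>: False
  show ?thesis
  proof (cases "deg \<Lambda> \<beta> = 0")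
    case True
    then have "\<beta> \<in> vertices \<Lambda>" using assms by (simp add: paths_def)
    then have \<beta>: "\<beta> = src \<Lambda> \<alpha>" using assms(3) by (simp add: vertexD)
    show ?thesis
      unfolding \<beta> fs_star_vertex[OF src_in_vertices[OF assms(1)]] comp_src[OF assms(1)]
      by (intro cls_relation KP2_src_star assms(1) \<alpha>)
  next
    case False
    then show ?thesis
      using \<alpha> assms by (intro cls_relation KP2_comp_star)
  qed
qed

lemma cls_fs_src: "\<alpha> \<in> mor \<Lambda> \<Longrightarrow> cls (fs \<Lambda> \<alpha>) = cls (fs \<Lambda> \<alpha> * fp (src \<Lambda> \<alpha>))"
  using cls_fs_comp[of \<alpha> "src \<Lambda> \<alpha>"] src_in_vertices[of \<alpha>]
  by (simp add: src_closed rng_src fs_vertex comp_src)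

lemma cls_fs_star_src: "\<alpha> \<in> mor \<Lambda> \<Longrightarrow> cls (fs_star \<Lambda> \<alpha>) = cls (fp (src \<Lambda> \<alpha>) * fs_star \<Lambda> \<alpha>)"
  using cls_fs_star_comp[of \<alpha> "src \<Lambda> \<alpha>"] src_in_vertices[of \<alpha>]
  by (simp add: src_closed rng_src fs_star_vertex comp_src)

lemma cls_fs_star_rng: "\<alpha> \<in> mor \<Lambda> \<Longrightarrow> cls (fs_star \<Lambda> \<alpha>) = cls (fs_star \<Lambda> \<alpha> * fp (rng \<Lambda> \<alpha>))"
  using cls_fs_star_comp[of "rng \<Lambda> \<alpha>" \<alpha>] rng_in_vertices[of \<alpha>]
  by (simp add: rng_closed src_rng fs_star_vertex comp_rng)

text \<open>Inserting \<open>fp v\<close> after \<open>x\<close> and \<open>fp w\<close> before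
  \<open>y\<close> leaves the product unchanged, while the two adjacent distinct vertices annihilate
  each other.\<close>

lemma cls_mult_orthogonal:
  assumes "cls x = cls (x * fp v)" "cls y = cls (fp w * y)" "v \<noteq> w"
    and "x \<in> carrier A" "y \<in> carrier A" "v \<in> vertices \<Lambda>" "w \<in> vertices \<Lambda>"
  shows "cls (x * y) = cls 0"
proof -
  have "cls (x * y) = cls (x * fp v * (fp w * y))"
    using assms by (intro cls_mult_cong) (simp_all add: fp_closed)
  also have "\<dots> = cls (x * (fp v * fp w) * y)"
    by (simp add: mult.assoc)
  also have "\<dots> = cls (x * 0 * y)"
    using assms cls_fp_mult[of v w] by (intro cls_mult_cong) (simp_all add: fp_closed)
  finally show ?thesis by simp
qed

lemma cls_fs_fs_star_eq_zero:
  assumes "\<alpha> \<in> mor \<Lambda>" "\<beta> \<in> mor \<Lambda>" "src \<Lambda> \<alpha> \<noteq> src \<Lambda> \<beta>"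
  shows "cls (fs \<Lambda> \<alpha> * fs_star \<Lambda> \<beta>) = cls 0"
  using assms
  by (intro cls_mult_orthogonal[OF cls_fs_src cls_fs_star_src])
    (simp_all add: fs_closed fs_star_closed src_in_vertices)

lemma cls_fs_star_fs_star_eq_zero:
  assumes "\<alpha> \<in> mor \<Lambda>" "\<beta> \<in> mor \<Lambda>" "rng \<Lambda> \<alpha> \<noteq> src \<Lambda> \<beta>"
  shows "cls (fs_star \<Lambda> \<alpha> * fs_star \<Lambda> \<beta>) = cls 0"
  using assms
  by (intro cls_mult_orthogonal[OF cls_fs_star_rng cls_fs_star_src])
    (simp_all add: fs_star_closed src_in_vertices rng_in_vertices)

text \<open>In degree zero both paths are vertices and (KP1) takes the place of (KP3).\<close>

lemma cls_fs_star_fs: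
  assumes "\<alpha> \<in> mor \<Lambda>" "\<beta> \<in> mor \<Lambda>" "deg \<Lambda> \<alpha> = deg \<Lambda> \<beta>"
  shows "cls (fs_star \<Lambda> \<alpha> * fs \<Lambda> \<beta>) = cls (if \<alpha> = \<beta> then fp (src \<Lambda> \<alpha>) else 0)"
proof (cases "deg \<Lambda> \<alpha> = 0")
  case True
  then have "\<alpha> \<in> vertices \<Lambda>" "\<beta> \<in> vertices \<Lambda>" using assms by (auto simp: paths_def)
  then show ?thesis by (simp add: fs_vertex fs_star_vertex vertexD cls_fp_mult)
next
  case False
  then show ?thesis using assms by (intro cls_relation KP3)
qed

lemma cls_fp_expand:
  assumes "v \<in> vertices \<Lambda>" "n \<in> nat_tuples k"
  shows "cls (fp v) = cls (\<Sum>\<alpha>\<in>paths_at \<Lambda> v n. fs \<Lambda> \<alpha> * fs_star \<Lambda> \<alpha>)"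
proof (cases "n = 0")
  case True
  then show ?thesis
    using assms by (simp add: paths_at_zero fs_vertex fs_star_vertex cls_fp_mult)
next
  case False
  then show ?thesis using assms by (intro cls_relation KP4)
qed

text \<open>Expanding \<open>p\<^bsub>s(\<gamma>)\<^esub>\<close> by (KP4) in degree \<open>d(\<beta>)\<close> makes all paths \<open>\<gamma>\<epsilon>\<close> long enough to be compared with \<open>\<beta>\<close>.\<close>

lemma cls_fs_fs_star_fs_in_span:
  assumes \<alpha>: "\<alpha> \<in> mor \<Lambda>" and \<beta>: "\<beta> \<in> mor \<Lambda>" and \<gamma>: "\<gamma> \<in> mor \<Lambda>"
    and T: "\<And>\<nu> \<epsilon>. \<lbrakk>\<nu> \<in> mor \<Lambda>; \<epsilon> \<in> mor \<Lambda>; src \<Lambda> \<alpha> = rng \<Lambda> \<nu>; src \<Lambda> \<beta> = rng \<Lambda> \<nu>; src \<Lambda> \<gamma> = rng \<Lambda> \<epsilon>;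
      comp \<Lambda> \<beta> \<nu> = comp \<Lambda> \<gamma> \<epsilon>\<rbrakk> \<Longrightarrow> cls (fs \<Lambda> (comp \<Lambda> \<alpha> \<nu>) * fs_star \<Lambda> \<epsilon>) \<in> T"
  shows "cls (fs \<Lambda> \<alpha> * fs_star \<Lambda> \<beta> * fs \<Lambda> \<gamma>) \<in> linear_span Q T"
proof (cases "src \<Lambda> \<alpha> = src \<Lambda> \<beta>")
  case False
  then have "cls (fs \<Lambda> \<alpha> * fs_star \<Lambda> \<beta> * fs \<Lambda> \<gamma>) = cls (0 * fs \<Lambda> \<gamma>)"
    using assms by (intro cls_mult_cong cls_fs_fs_star_eq_zero) (simp_all add: fs_closed fs_star_closed)
  then show ?thesis using linear_span.span_zero[of Q T] by simp
next
  case src: True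
  note [simp] = fs_closed fs_star_closed fp_closed src_in_vertices rng_in_vertices \<alpha> \<beta> \<gamma>
  let ?t = "fs \<Lambda> \<alpha> * fs_star \<Lambda> \<beta>" and ?P = "paths_at \<Lambda> (src \<Lambda> \<gamma>) (deg \<Lambda> \<beta>)"
  have "cls (?t * fs \<Lambda> \<gamma>) = cls (?t * (fs \<Lambda> \<gamma> * fp (src \<Lambda> \<gamma>)))"
    by (intro cls_mult_cong cls_fs_src) simp_all
  also have "\<dots> = cls (?t * (fs \<Lambda> \<gamma> * (\<Sum>\<epsilon>\<in>?P. fs \<Lambda> \<epsilon> * fs_star \<Lambda> \<epsilon>)))"
    by (intro cls_mult_cong cls_fp_expand) (simp_all add: deg_closed path_sum_closed)
  also have "\<dots> = cls (\<Sum>\<epsilon>\<in>?P. ?t * (fs \<Lambda> \<gamma> * (fs \<Lambda> \<epsilon> * fs_star \<Lambda> \<epsilon>)))"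
    by (simp add: sum_distrib_left)
  also have "\<dots> \<in> linear_span Q T"
  proof (rule cls_sum_in_span)
    fix \<epsilon> assume "\<epsilon> \<in> ?P"
    then have \<epsilon>: "\<epsilon> \<in> mor \<Lambda>" "deg \<Lambda> \<epsilon> = deg \<Lambda> \<beta>" "rng \<Lambda> \<epsilon> = src \<Lambda> \<gamma>"
      by (auto dest: paths_atD)
    \<comment> \<open>The path \<gamma>\<epsilon> has degree d(\<gamma>) + d(\<beta>); splitting off
      an initial piece \<mu> of degree d(\<beta>) brings it into the range of (KP3).\<close>
    have "\<exists>!(\<mu>, \<nu>). \<mu> \<in> mor \<Lambda> \<and> \<nu> \<in> mor \<Lambda> \<and> src \<Lambda> \<mu> = rng \<Lambda> \<nu>
        \<and> comp \<Lambda> \<gamma> \<epsilon> = comp \<Lambda> \<mu> \<nu> \<and> deg \<Lambda> \<mu> = deg \<Lambda> \<beta> \<and> deg \<Lambda> \<nu> = deg \<Lambda> \<gamma>"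
      using \<epsilon> by (intro factorisation) (simp_all add: comp_closed deg_closed deg_comp add.commute)
    then obtain \<mu> \<nu> where \<mu>\<nu>: "\<mu> \<in> mor \<Lambda>" "\<nu> \<in> mor \<Lambda>" "src \<Lambda> \<mu> = rng \<Lambda> \<nu>"
      "comp \<Lambda> \<gamma> \<epsilon> = comp \<Lambda> \<mu> \<nu>" "deg \<Lambda> \<mu> = deg \<Lambda> \<beta>"
      by (auto simp: Ex1_def)
    note [simp] = \<epsilon>(1) \<mu>\<nu>(1,2)
    have "cls (fs \<Lambda> \<gamma> * fs \<Lambda> \<epsilon>) = cls (fs \<Lambda> \<mu> * fs \<Lambda> \<nu>)"
      using \<mu>\<nu> \<epsilon> by (simp add: cls_fs_comp)
    then have "cls (fs \<Lambda> \<alpha> * fs_star \<Lambda> \<beta> * ((fs \<Lambda> \<gamma> * fs \<Lambda> \<epsilon>) * fs_star \<Lambda> \<epsilon>))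
        = cls (fs \<Lambda> \<alpha> * fs_star \<Lambda> \<beta> * ((fs \<Lambda> \<mu> * fs \<Lambda> \<nu>) * fs_star \<Lambda> \<epsilon>))"
      by (intro cls_mult_cong[OF refl] cls_mult_cong[OF _ refl, of "_ * _"]) simp_all
    also have "\<dots> = cls (fs \<Lambda> \<alpha> * (fs_star \<Lambda> \<beta> * fs \<Lambda> \<mu>) * (fs \<Lambda> \<nu> * fs_star \<Lambda> \<epsilon>))"
      by (simp add: mult.assoc)
    \<comment> \<open>The term vanishes unless \<mu> = \<beta>, and then \<beta>\<nu> =
      \<gamma>\<epsilon> is the equation under which \<open>T\<close> applies.\<close>
    also have "\<dots> = cls (fs \<Lambda> \<alpha> * (if \<beta> = \<mu> then fp (src \<Lambda> \<beta>) else 0) * (fs \<Lambda> \<nu> * fs_star \<Lambda> \<epsilon>))"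
      using \<mu>\<nu> by (intro cls_mult_cong cls_fs_star_fs) simp_all
    also have "\<dots> \<in> linear_span Q T"
    proof (cases "\<beta> = \<mu>")
      case True
      have "cls (fs \<Lambda> \<alpha> * fp (src \<Lambda> \<beta>) * (fs \<Lambda> \<nu> * fs_star \<Lambda> \<epsilon>)) = cls (fs \<Lambda> \<alpha> * (fs \<Lambda> \<nu> * fs_star \<Lambda> \<epsilon>))"
        using cls_fs_src[of \<alpha>] src by (intro cls_mult_cong) simp_all
      also have "\<dots> = cls (fs \<Lambda> \<alpha> * fs \<Lambda> \<nu> * fs_star \<Lambda> \<epsilon>)"
        by (simp add: mult.assoc)
      also have "\<dots> = cls (fs \<Lambda> (comp \<Lambda> \<alpha> \<nu>) * fs_star \<Lambda> \<epsilon>)"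
        using True src \<mu>\<nu> by (intro cls_mult_cong cls_fs_comp) (simp_all add: comp_closed)
      also have "\<dots> \<in> linear_span Q T"
        using True src \<mu>\<nu> \<epsilon> by (intro linear_span.span_base T) simp_all
      finally show ?thesis using True by simp
    next
      case False
      then show ?thesis using linear_span.span_zero[of Q T] by simp
    qed
    finally show "cls (?t * (fs \<Lambda> \<gamma> * (fs \<Lambda> \<epsilon> * fs_star \<Lambda> \<epsilon>))) \<in> linear_span Q T"
      by (simp add: mult.assoc)
  qed
  finally show ?thesis .
qed

end

section \<open>The grading of the Kumjian--Pask algebra\<close>

text \<open>Letters outside the graph get degree \<open>\<one>\<close>, so that the degree is a total map into the group.\<close>

primrec kp_gen_degree :: "'m kgraph \<Rightarrow> ('g, 'z) monoid_scheme \<Rightarrow> ('m \<Rightarrow> 'g) \<Rightarrow> 'm kp_gen \<Rightarrow> 'g" where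
  "kp_gen_degree \<Lambda> G \<eta> (Vertex v) = \<one>\<^bsub>G\<^esub>"
| "kp_gen_degree \<Lambda> G \<eta> (Path \<alpha>) = (if \<alpha> \<in> mor \<Lambda> then \<eta> \<alpha> else \<one>\<^bsub>G\<^esub>)"
| "kp_gen_degree \<Lambda> G \<eta> (Ghost \<alpha>) = (if \<alpha> \<in> mor \<Lambda> then inv\<^bsub>G\<^esub> (\<eta> \<alpha>) else \<one>\<^bsub>G\<^esub>)"

locale kumjian_pask_functor = kumjian_pask k \<Lambda> K + group G
  for k and \<Lambda> :: "'m kgraph" and K :: "'k::field itself" and G (structure) +
  fixes \<eta> :: "'m \<Rightarrow> 'b"
  assumes eta_functor: "functor_to_group \<Lambda> G \<eta>"
begin

lemma eta_closed [simp]: "\<alpha> \<in> mor \<Lambda> \<Longrightarrow> \<eta> \<alpha> \<in> carrier G"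
  using eta_functor by (simp add: functor_to_group_def)

lemma eta_comp: "\<lbrakk>\<alpha> \<in> mor \<Lambda>; \<beta> \<in> mor \<Lambda>; src \<Lambda> \<alpha> = rng \<Lambda> \<beta>\<rbrakk> \<Longrightarrow> \<eta> (comp \<Lambda> \<alpha> \<beta>) = \<eta> \<alpha> \<otimes> \<eta> \<beta>"
  using eta_functor by (simp add: functor_to_group_def)

lemma eta_vertex: "v \<in> vertices \<Lambda> \<Longrightarrow> \<eta> v = \<one>"
  using eta_functor by (simp add: functor_to_group_def)

sublocale graded_generators G "kp_gens \<Lambda>" "kp_gen_degree \<Lambda> G \<eta>"
proof
  show "kp_gen_degree \<Lambda> G \<eta> x \<in> carrier G" for x
    by (cases x) auto
qed

section \<open>Homogeneity of the relations\<close>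

lemma fp_homogeneous: "v \<in> vertices \<Lambda> \<Longrightarrow> fp v \<in> homogeneous_part \<one>"
  using letter_homogeneous[of "Vertex v"] by (simp add: fp_def kp_gens_def)

lemma fs_homogeneous:
  assumes "\<alpha> \<in> mor \<Lambda>"
  shows "fs \<Lambda> \<alpha> \<in> homogeneous_part (\<eta> \<alpha>)"
proof (cases "deg \<Lambda> \<alpha> = 0")
  case True
  then have "\<alpha> \<in> vertices \<Lambda>" using assms by (simp add: paths_def)
  then show ?thesis using fp_homogeneous by (simp add: fs_vertex eta_vertex)
next
  case False
  then show ?thesis
    using letter_homogeneous[of "Path \<alpha>"] assms by (simp add: fs_def kp_gens_def)
qed

lemma fs_star_homogeneous:
  assumes "\<alpha> \<in> mor \<Lambda>"
  shows "fs_star \<Lambda> \<alpha> \<in> homogeneous_part (inv (\<eta> \<alpha>))"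
proof (cases "deg \<Lambda> \<alpha> = 0")
  case True
  then have "\<alpha> \<in> vertices \<Lambda>" using assms by (simp add: paths_def)
  then show ?thesis using fp_homogeneous by (simp add: fs_star_vertex eta_vertex)
next
  case False
  then show ?thesis
    using letter_homogeneous[of "Ghost \<alpha>"] assms by (simp add: fs_star_def kp_gens_def)
qed

text \<open>(KP2) is homogeneous because \<eta> is multiplicative and trivial on vertices; in (KP4)
  each summand has degree \<eta>(\<alpha>)\<eta>(\<alpha>)^-1, the identity.\<close>

lemma kp_relations_homogeneous:
  assumes "r \<in> kp_relations k \<Lambda>"
  shows "\<exists>g. r \<in> homogeneous_part g"
proof -
  note hom = fp_homogeneous fs_homogeneous fs_star_homogeneous homogeneous_part_mult
  from assms show ?thesis
  proof cases
    case (KP1_idem v)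
    have "fp v * fp v \<in> homogeneous_part (\<one> \<otimes> \<one>)"
      using KP1_idem by (intro hom)
    then show ?thesis using KP1_idem by (auto intro: homogeneous_part_diff hom)
  next
    case (KP1_orth v w)
    then show ?thesis by (blast intro: hom)
  next
    case (KP2_comp \<alpha> \<beta>)
    have "fs \<Lambda> \<alpha> * fs \<Lambda> \<beta> \<in> homogeneous_part (\<eta> (comp \<Lambda> \<alpha> \<beta>))"
      using KP2_comp by (simp add: eta_comp hom)
    then show ?thesis
      using KP2_comp homogeneous_part_diff fs_homogeneous comp_closed by blast
  next
    case (KP2_comp_star \<alpha> \<beta>)
    have "fs_star \<Lambda> \<beta> * fs_star \<Lambda> \<alpha> \<in> homogeneous_part (inv (\<eta> (comp \<Lambda> \<alpha> \<beta>)))"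
      using KP2_comp_star by (simp add: eta_comp hom inv_mult_group)
    then show ?thesis
      using KP2_comp_star homogeneous_part_diff fs_star_homogeneous comp_closed by blast
  next
    case (KP2_rng \<alpha>)
    have "fp (rng \<Lambda> \<alpha>) * fs \<Lambda> \<alpha> \<in> homogeneous_part (\<one> \<otimes> \<eta> \<alpha>)"
      using KP2_rng by (intro hom rng_in_vertices)
    then show ?thesis using KP2_rng by (auto intro: homogeneous_part_diff hom)
  next
    case (KP2_src \<alpha>)
    have "fs \<Lambda> \<alpha> * fp (src \<Lambda> \<alpha>) \<in> homogeneous_part (\<eta> \<alpha> \<otimes> \<one>)"
      using KP2_src by (intro hom src_in_vertices)
    then show ?thesis using KP2_src by (auto intro: homogeneous_part_diff hom)
  next
    case (KP2_src_star \<alpha>)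
    have "fp (src \<Lambda> \<alpha>) * fs_star \<Lambda> \<alpha> \<in> homogeneous_part (\<one> \<otimes> inv (\<eta> \<alpha>))"
      using KP2_src_star by (intro hom src_in_vertices)
    then show ?thesis using KP2_src_star by (auto intro: homogeneous_part_diff hom)
  next
    case (KP2_rng_star \<alpha>)
    have "fs_star \<Lambda> \<alpha> * fp (rng \<Lambda> \<alpha>) \<in> homogeneous_part (inv (\<eta> \<alpha>) \<otimes> \<one>)"
      using KP2_rng_star by (intro hom rng_in_vertices)
    then show ?thesis using KP2_rng_star by (auto intro: homogeneous_part_diff hom)
  next
    case (KP3 \<alpha> \<beta>)
    have "fs_star \<Lambda> \<alpha> * fs \<Lambda> \<beta> \<in> homogeneous_part (inv (\<eta> \<alpha>) \<otimes> \<eta> \<beta>)"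
      using KP3 by (intro hom)
    \<comment> \<open>On the diagonal the degree is the identity, that of a vertex; off the
      diagonal, \<open>0\<close> is homogeneous of every degree.\<close>
    moreover have "(if \<alpha> = \<beta> then fp (src \<Lambda> \<alpha>) else 0) \<in> homogeneous_part (inv (\<eta> \<alpha>) \<otimes> \<eta> \<beta>)"
      using KP3 by (simp add: fp_homogeneous src_in_vertices homogeneous_part_zero)
    ultimately show ?thesis using KP3 homogeneous_part_diff by blast
  next
    case (KP4 v n)
    have "fs \<Lambda> \<alpha> * fs_star \<Lambda> \<alpha> \<in> homogeneous_part \<one>" if "\<alpha> \<in> mor \<Lambda>" for \<alpha>
      using homogeneous_part_mult[OF fs_homogeneous[OF that] fs_star_homogeneous[OF that]] that by simp
    then have "(\<Sum>\<alpha>\<in>paths_at \<Lambda> v n. fs \<Lambda> \<alpha> * fs_star \<Lambda> \<alpha>) \<in> homogeneous_part \<one>"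
      by (intro homogeneous_part_sum) (blast dest: paths_atD)
    then show ?thesis
      using KP4 homogeneous_part_diff fp_homogeneous by blast
  qed
qed

sublocale graded_presentation "kp_gens \<Lambda>" "kp_relations k \<Lambda> :: ('m kp_gen free_monoid \<Rightarrow>\<^sub>0 'k) set"
    G "kp_gen_degree \<Lambda> G \<eta>"
  by unfold_locales (rule kp_relations_homogeneous)

section \<open>Reduction of words to the elements
  \<open>s\<^sub>\<alpha> s\<^sub>\<beta>\<^sub>*\<close>\<close>

definition spanning :: "'b \<Rightarrow> ('m kp_gen free_monoid \<Rightarrow>\<^sub>0 'k) set" where
  "spanning g = {fs \<Lambda> \<alpha> * fs_star \<Lambda> \<beta> | \<alpha> \<beta>. \<alpha> \<in> mor \<Lambda> \<and> \<beta> \<in> mor \<Lambda> \<and> \<eta> \<alpha> \<otimes> inv (\<eta> \<beta>) = g}"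

lemma spanningI:
  "\<lbrakk>\<alpha> \<in> mor \<Lambda>; \<beta> \<in> mor \<Lambda>; \<eta> \<alpha> \<otimes> inv (\<eta> \<beta>) = g\<rbrakk> \<Longrightarrow> fs \<Lambda> \<alpha> * fs_star \<Lambda> \<beta> \<in> spanning g"
  by (auto simp: spanning_def)

text \<open>The second factor is the vertex s(\<alpha>), regarded as a ghost path of trivial
  degree.\<close>

lemma cls_fs_in_span:
  assumes "\<alpha> \<in> mor \<Lambda>"
  shows "cls (fs \<Lambda> \<alpha>) \<in> linear_span Q (cls ` spanning (\<eta> \<alpha>))"
proof -
  note v = src_in_vertices[OF assms]
  have "cls (fs \<Lambda> \<alpha>) = cls (fs \<Lambda> \<alpha> * fs_star \<Lambda> (src \<Lambda> \<alpha>))"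
    using cls_fs_src[OF assms] v by (simp add: fs_star_vertex)
  then show ?thesis
    using assms v vertexD(1)[OF v]
    by (auto intro!: linear_span.span_base spanningI simp: eta_vertex)
qed

lemma cls_fs_star_in_span:
  assumes "\<alpha> \<in> mor \<Lambda>"
  shows "cls (fs_star \<Lambda> \<alpha>) \<in> linear_span Q (cls ` spanning (inv (\<eta> \<alpha>)))"
proof -
  note v = src_in_vertices[OF assms]
  have "cls (fs_star \<Lambda> \<alpha>) = cls (fs \<Lambda> (src \<Lambda> \<alpha>) * fs_star \<Lambda> \<alpha>)"
    using cls_fs_star_src[OF assms] v by (simp add: fs_vertex)
  then show ?thesis
    using assms v vertexD(1)[OF v]
    by (auto intro!: linear_span.span_base spanningI simp: eta_vertex)
qed

text \<open>Degrees match because \<beta>\<nu> = \<gamma>\<epsilon> forces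
  \<eta>(\<nu>)\<eta>(\<epsilon>)^-1 = \<eta>(\<beta>)^-1\<eta>(\<gamma>).\<close>

lemma cls_spanning_fs_in_span:
  assumes "t \<in> spanning g" "\<gamma> \<in> mor \<Lambda>"
  shows "cls (t * fs \<Lambda> \<gamma>) \<in> linear_span Q (cls ` spanning (g \<otimes> \<eta> \<gamma>))"
proof -
  obtain \<alpha> \<beta> where t: "t = fs \<Lambda> \<alpha> * fs_star \<Lambda> \<beta>" and \<alpha>: "\<alpha> \<in> mor \<Lambda>" and \<beta>: "\<beta> \<in> mor \<Lambda>"
    and g: "g = \<eta> \<alpha> \<otimes> inv (\<eta> \<beta>)"
    using assms(1) by (auto simp: spanning_def)
  show ?thesis
    unfolding t
  proof (rule cls_fs_fs_star_fs_in_span[OF \<alpha> \<beta> assms(2)], rule imageI)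
    fix \<nu> \<epsilon> assume *: "\<nu> \<in> mor \<Lambda>" "\<epsilon> \<in> mor \<Lambda>" "src \<Lambda> \<alpha> = rng \<Lambda> \<nu>" "src \<Lambda> \<beta> = rng \<Lambda> \<nu>"
      "src \<Lambda> \<gamma> = rng \<Lambda> \<epsilon>" "comp \<Lambda> \<beta> \<nu> = comp \<Lambda> \<gamma> \<epsilon>"
    have "\<eta> \<beta> \<otimes> \<eta> \<nu> = \<eta> \<gamma> \<otimes> \<eta> \<epsilon>"
      using * \<beta> assms(2) by (metis eta_comp)
    then have "\<eta> \<nu> = inv (\<eta> \<beta>) \<otimes> (\<eta> \<gamma> \<otimes> \<eta> \<epsilon>)"
      using * \<beta> assms(2) by (metis eta_closed inv_solve_left m_closed)
    then have "\<eta> (comp \<Lambda> \<alpha> \<nu>) \<otimes> inv (\<eta> \<epsilon>) = g \<otimes> \<eta> \<gamma>"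
      using * \<alpha> \<beta> assms(2) by (simp add: eta_comp g m_assoc)
    then show "fs \<Lambda> (comp \<Lambda> \<alpha> \<nu>) * fs_star \<Lambda> \<epsilon> \<in> spanning (g \<otimes> \<eta> \<gamma>)"
      using * \<alpha> by (intro spanningI comp_closed)
  qed
qed

text \<open>The ghost factors either merge into the ghost of \<gamma>\<beta> or, when \<gamma> and
  \<beta> are not composable, multiply to zero.\<close>

lemma cls_spanning_fs_star_in_span:
  assumes "t \<in> spanning g" "\<gamma> \<in> mor \<Lambda>"
  shows "cls (t * fs_star \<Lambda> \<gamma>) \<in> linear_span Q (cls ` spanning (g \<otimes> inv (\<eta> \<gamma>)))"
proof -
  obtain \<alpha> \<beta> where t: "t = fs \<Lambda> \<alpha> * fs_star \<Lambda> \<beta>" and \<alpha>: "\<alpha> \<in> mor \<Lambda>" and \<beta>: "\<beta> \<in> mor \<Lambda>"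
    and g: "g = \<eta> \<alpha> \<otimes> inv (\<eta> \<beta>)"
    using assms(1) by (auto simp: spanning_def)
  show ?thesis
  proof (cases "src \<Lambda> \<gamma> = rng \<Lambda> \<beta>")
    case True
    have "cls (fs \<Lambda> \<alpha> * (fs_star \<Lambda> \<beta> * fs_star \<Lambda> \<gamma>)) = cls (fs \<Lambda> \<alpha> * fs_star \<Lambda> (comp \<Lambda> \<gamma> \<beta>))"
      using True \<alpha> \<beta> assms(2)
      by (intro cls_mult_cong cls_fs_star_comp) (simp_all add: fs_closed fs_star_closed comp_closed)
    moreover have "fs \<Lambda> \<alpha> * fs_star \<Lambda> (comp \<Lambda> \<gamma> \<beta>) \<in> spanning (g \<otimes> inv (\<eta> \<gamma>))"
      using True \<alpha> \<beta> assms(2)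
      by (intro spanningI) (simp_all add: comp_closed eta_comp inv_mult_group g m_assoc)
    ultimately show ?thesis by (auto simp: t mult.assoc intro: linear_span.span_base)
  next
    case False
    have "cls (fs \<Lambda> \<alpha> * (fs_star \<Lambda> \<beta> * fs_star \<Lambda> \<gamma>)) = cls (fs \<Lambda> \<alpha> * 0)"
      using False \<alpha> \<beta> assms(2)
      by (intro cls_mult_cong cls_fs_star_fs_star_eq_zero) (auto simp: fs_closed fs_star_closed)
    then show ?thesis
      using linear_span.span_zero[of Q] by (simp add: t mult.assoc)
  qed
qed

text \<open>A vertex generator is treated as a path of degree zero, so the spanning criterion has
  two kinds of letters to consider.\<close>

lemma kp_gen_cases:
  assumes "x \<in> kp_gens \<Lambda>"
  obtains \<gamma> where "\<gamma> \<in> mor \<Lambda>" "letter x = (fs \<Lambda> \<gamma> :: _ \<Rightarrow>\<^sub>0 'k)" "kp_gen_degree \<Lambda> G \<eta> x = \<eta> \<gamma>"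
  | \<gamma> where "\<gamma> \<in> mor \<Lambda>" "letter x = (fs_star \<Lambda> \<gamma> :: _ \<Rightarrow>\<^sub>0 'k)" "kp_gen_degree \<Lambda> G \<eta> x = inv (\<eta> \<gamma>)"
proof (cases x)
  case (Vertex v)
  then have "v \<in> vertices \<Lambda>" using assms by (auto simp: kp_gens_def)
  then show ?thesis
    using Vertex by (intro that(1)[of v]) (auto simp: vertexD fs_vertex fp_def eta_vertex)
next
  case (Path \<alpha>)
  then show ?thesis using assms by (intro that(1)[of \<alpha>]) (auto simp: kp_gens_def fs_def)
next
  case (Ghost \<alpha>)
  then show ?thesis using assms by (intro that(2)[of \<alpha>]) (auto simp: kp_gens_def fs_star_def)
qed

lemma homogeneous_part_eq_span_spanning:
  assumes "g \<in> carrier G"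
  shows "cls ` homogeneous_part g = linear_span Q (cls ` spanning g)"
proof (rule homogeneous_part_eq_span[OF _ _ _ assms])
  show "spanning g \<subseteq> homogeneous_part g" for g
    by (auto simp: spanning_def intro: homogeneous_part_mult fs_homogeneous fs_star_homogeneous)
next
  fix x assume "x \<in> kp_gens \<Lambda>"
  then show "cls (letter x) \<in> linear_span Q (cls ` spanning (kp_gen_degree \<Lambda> G \<eta> x))"
    by (cases rule: kp_gen_cases) (simp_all add: cls_fs_in_span cls_fs_star_in_span)
next
  fix g t x assume "t \<in> spanning g" "x \<in> kp_gens \<Lambda>"
  from this(2,1) show "cls (t * letter x) \<in> linear_span Q (cls ` spanning (g \<otimes> kp_gen_degree \<Lambda> G \<eta> x))"
    by (cases rule: kp_gen_cases) (simp_all add: cls_spanning_fs_in_span cls_spanning_fs_star_in_span)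
qed

end

text \<open>The homogeneous parts and the spans are known to agree for degrees in
  \<open>carrier G\<close>, which are the degrees that \<open>is_grading\<close> inspects;
  \<open>group G\<close> keeps products of degrees there.\<close>

lemma is_grading_cong:
  assumes "is_grading G R D" "group G" "\<And>g. g \<in> carrier G \<Longrightarrow> D g = D' g"
  shows "is_grading G R D'"
proof -
  interpret group G by fact
  have "(\<Pi>\<^sub>E g\<in>carrier G. D g) = (\<Pi>\<^sub>E g\<in>carrier G. D' g)"
    using assms(3) by (intro PiE_cong)
  then show ?thesis
    using assms(1,3) by (simp add: is_grading_def)
qed

theorem propositionC1:
  fixes k :: nat
    and \<Lambda> :: "'m kgraph"
    and G :: "('g, 'x) monoid_scheme"
    and \<eta> :: "'m \<Rightarrow> 'g"
  assumes "k_graph k \<Lambda>"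
    and "row_finite_no_sources k \<Lambda>"
    and "group G"
    and "functor_to_group \<Lambda> G \<eta>"
  shows "is_grading G (kp_algebra k \<Lambda> :: ('k::field, _) module)
    (\<lambda>g. linear_span (kp_algebra k \<Lambda>)
      {kp_s k \<Lambda> \<alpha> \<otimes>\<^bsub>kp_algebra k \<Lambda>\<^esub> kp_s_star k \<Lambda> \<beta> | \<alpha> \<beta>.
        \<alpha> \<in> mor \<Lambda> \<and> \<beta> \<in> mor \<Lambda> \<and> \<eta> \<alpha> \<otimes>\<^bsub>G\<^esub> inv\<^bsub>G\<^esub> (\<eta> \<beta>) = g})"
proof -
  interpret kumjian_pask_functor k \<Lambda> "TYPE('k)" G \<eta>
    using assms by (intro kumjian_pask_functor.intro kumjian_pask.intro kumjian_pask_functor_axioms.intro)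
  have Q: "kp_algebra k \<Lambda> = Q"
    by (simp add: kp_algebra_def kp_ideal_def)
  \<comment> \<open>Multiplication of cosets turns the generators of the stated spans into the
    classes of \<open>spanning g\<close>.\<close>
  have "cls (fs \<Lambda> \<alpha> * fs_star \<Lambda> \<beta>) = kp_s k \<Lambda> \<alpha> \<otimes>\<^bsub>Q\<^esub> kp_s_star k \<Lambda> \<beta>"
    if "\<alpha> \<in> mor \<Lambda>" "\<beta> \<in> mor \<Lambda>" for \<alpha> \<beta>
    using that by (simp add: kp_s_def kp_s_star_def kp_ideal_def fs_closed fs_star_closed)
  then have "cls ` spanning g = {kp_s k \<Lambda> \<alpha> \<otimes>\<^bsub>Q\<^esub> kp_s_star k \<Lambda> \<beta> | \<alpha> \<beta>.
      \<alpha> \<in> mor \<Lambda> \<and> \<beta> \<in> mor \<Lambda> \<and> \<eta> \<alpha> \<otimes>\<^bsub>G\<^esub> inv\<^bsub>G\<^esub> (\<eta> \<beta>) = g}" for g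
    unfolding spanning_def by (fastforce simp: image_iff)
  then show ?thesis
    using is_grading_cong[OF grading_by_homogeneous_parts assms(3) homogeneous_part_eq_span_spanning]
    by (simp add: Q)
qed

end
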